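(* A complete first-order theory $T$ has $k$-ATP for some integer $k\ge 2$ if and only if $T$ has ATP.
   Context: Let $\mathbb{M}$ be a monster model of $T$. $2^{<\omega}$ is the set of finite $0/1$-strings ordered by initial segment $\trianglelefteq$; an antichain is a set of pairwise incomparable elements. For an integer $k\ge 2$, a formula $\varphi(x;y)$ has the $k$-antichain tree property ($k$-ATP) if there is a tree of parameters $(a_\eta)_{\eta\in 2^{<\omega}}$ in $\mathbb{M}$ such that: for every antichain $A\subseteq 2^{<\omega}$, $\{\varphi(x;a_\eta):\eta\in A\}$ is consistent; and for any pairwise comparable distinct elements $\eta_0,\ldots,\eta_{k-1}\in 2^{<\omega}$, $\{\varphi(x;a_{\eta_i}):i<k\}$ is inconsistent. $T$ has $k$-ATP if some formula has $k$-ATP. ATP is $2$-ATP. *)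

theory Defs
  imports Main "HOL-Library.Sublist"
begin

unbundle cardinal_syntax

section \<open>First-order syntax\<close>

text \<open>The symbols of a language are subsets of two types, so that either kind of symbol may be absent.\<close>

record ('f, 'r) lang =
  Funs :: "'f set"
  Rels :: "'r set"
  farity :: "'f \<Rightarrow> nat"
  rarity :: "'r \<Rightarrow> nat"

datatype 'f tm = Var nat | Fn 'f "'f tm list"

datatype ('f, 'r) fm =
    Eq "'f tm" "'f tm"
  | Rl 'r "'f tm list"
  | Neg "('f, 'r) fm"
  | And "('f, 'r) fm" "('f, 'r) fm"
  | Ex nat "('f, 'r) fm"

fun wf_tm :: "('f, 'r) lang \<Rightarrow> 'f tm \<Rightarrow> bool" where
  "wf_tm L (Var v) \<longleftrightarrow> True"
| "wf_tm L (Fn f ts) \<longleftrightarrow> f \<in> Funs L \<and> length ts = farity L f \<and> (\<forall>t\<in>set ts. wf_tm L t)"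

fun wf_fm :: "('f, 'r) lang \<Rightarrow> ('f, 'r) fm \<Rightarrow> bool" where
  "wf_fm L (Eq s t) \<longleftrightarrow> wf_tm L s \<and> wf_tm L t"
| "wf_fm L (Rl r ts) \<longleftrightarrow> r \<in> Rels L \<and> length ts = rarity L r \<and> (\<forall>t\<in>set ts. wf_tm L t)"
| "wf_fm L (Neg \<phi>) \<longleftrightarrow> wf_fm L \<phi>"
| "wf_fm L (And \<phi> \<psi>) \<longleftrightarrow> wf_fm L \<phi> \<and> wf_fm L \<psi>"
| "wf_fm L (Ex v \<phi>) \<longleftrightarrow> wf_fm L \<phi>"

fun fv_tm :: "'f tm \<Rightarrow> nat set" where
  "fv_tm (Var v) = {v}"
| "fv_tm (Fn f ts) = (\<Union>t\<in>set ts. fv_tm t)"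

fun fv :: "('f, 'r) fm \<Rightarrow> nat set" where
  "fv (Eq s t) = fv_tm s \<union> fv_tm t"
| "fv (Rl r ts) = (\<Union>t\<in>set ts. fv_tm t)"
| "fv (Neg \<phi>) = fv \<phi>"
| "fv (And \<phi> \<psi>) = fv \<phi> \<union> fv \<psi>"
| "fv (Ex v \<phi>) = fv \<phi> - {v}"

definition sentence :: "('f, 'r) lang \<Rightarrow> ('f, 'r) fm \<Rightarrow> bool" where
  "sentence L \<phi> \<longleftrightarrow> wf_fm L \<phi> \<and> fv \<phi> = {}"


section \<open>Structures, satisfaction, complete theories\<close>

record ('f, 'r, 'm) struct =
  dom :: "'m set"
  fint :: "'f \<Rightarrow> 'm list \<Rightarrow> 'm"
  rint :: "'r \<Rightarrow> 'm list \<Rightarrow> bool"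

definition is_struct :: "('f, 'r) lang \<Rightarrow> ('f, 'r, 'm) struct \<Rightarrow> bool" where
  "is_struct L M \<longleftrightarrow> dom M \<noteq> {} \<and>
     (\<forall>f\<in>Funs L. \<forall>bs. set bs \<subseteq> dom M \<and> length bs = farity L f \<longrightarrow> fint M f bs \<in> dom M)"

fun tm_val :: "('f, 'r, 'm) struct \<Rightarrow> (nat \<Rightarrow> 'm) \<Rightarrow> 'f tm \<Rightarrow> 'm" where
  "tm_val M e (Var v) = e v"
| "tm_val M e (Fn f ts) = fint M f (map (tm_val M e) ts)"

fun sat :: "('f, 'r, 'm) struct \<Rightarrow> (nat \<Rightarrow> 'm) \<Rightarrow> ('f, 'r) fm \<Rightarrow> bool" where
  "sat M e (Eq s t) \<longleftrightarrow> tm_val M e s = tm_val M e t"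
| "sat M e (Rl r ts) \<longleftrightarrow> rint M r (map (tm_val M e) ts)"
| "sat M e (Neg \<phi>) \<longleftrightarrow> \<not> sat M e \<phi>"
| "sat M e (And \<phi> \<psi>) \<longleftrightarrow> sat M e \<phi> \<and> sat M e \<psi>"
| "sat M e (Ex v \<phi>) \<longleftrightarrow> (\<exists>b\<in>dom M. sat M (e(v := b)) \<phi>)"

text \<open>For sentences the assignment is irrelevant.\<close>

definition model_of ::
  "('f, 'r) lang \<Rightarrow> ('f, 'r) fm set \<Rightarrow> ('f, 'r, 'm) struct \<Rightarrow> bool" where
  "model_of L T M \<longleftrightarrow> is_struct L M \<and> (\<forall>\<phi>\<in>T. \<forall>e. sat M e \<phi>)"

text \<open>A definition in HOL cannot quantify over structures of all types. The models in the next two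
definitions have their domain inside the type of formulas; by downward Loewenheim-Skolem this is no
restriction, since that type is infinite and at least as large as the set of \<open>L\<close>-formulas.\<close>

definition entails :: "('f, 'r) lang \<Rightarrow> ('f, 'r) fm set \<Rightarrow> ('f, 'r) fm \<Rightarrow> bool" where
  "entails L T \<phi> \<longleftrightarrow>
     (\<forall>M :: ('f, 'r, ('f, 'r) fm) struct. model_of L T M \<longrightarrow> (\<forall>e. sat M e \<phi>))"

definition complete_theory :: "('f, 'r) lang \<Rightarrow> ('f, 'r) fm set \<Rightarrow> bool" where
  "complete_theory L T \<longleftrightarrow>
     (\<forall>\<phi>\<in>T. sentence L \<phi>) \<and>
     (\<exists>M :: ('f, 'r, ('f, 'r) fm) struct. model_of L T M) \<and>
     (\<forall>\<phi>. sentence L \<phi> \<longrightarrow> entails L T \<phi> \<or> entails L T (Neg \<phi>))"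


section \<open>Formulas with parameters and consistency\<close>

definition assign :: "(nat \<Rightarrow> 'm) \<Rightarrow> nat list \<Rightarrow> 'm list \<Rightarrow> nat \<Rightarrow> 'm" where
  "assign e vs bs = (\<lambda>v. case map_of (zip vs bs) v of Some b \<Rightarrow> b | None \<Rightarrow> e v)"

definition tuples :: "('f, 'r, 'm) struct \<Rightarrow> nat list \<Rightarrow> 'm list set" where
  "tuples M vs = {bs. length bs = length vs \<and> set bs \<subseteq> dom M}"

text \<open>A formula with parameters in the tuple of variables \<open>xs\<close> is a pair \<open>(\<phi>, e)\<close>: the free
variables of \<open>\<phi>\<close> outside \<open>xs\<close> stand for the parameters assigned to them by \<open>e\<close>.\<close>

type_synonym ('f, 'r, 'm) pfm = "('f, 'r) fm \<times> (nat \<Rightarrow> 'm)"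

definition over ::
  "('f, 'r) lang \<Rightarrow> nat list \<Rightarrow> 'm set \<Rightarrow> ('f, 'r, 'm) pfm set" where
  "over L xs A = {(\<phi>, e). wf_fm L \<phi> \<and> e ` (fv \<phi> - set xs) \<subseteq> A}"

text \<open>The usual convention in a monster model: a set of formulas over a small set of parameters
is consistent when it is realized in the monster model. Lemma \<open>consistent_iff_finitely\<close> below
relates this to finite satisfiability.\<close>

definition consistent ::
  "('f, 'r, 'm) struct \<Rightarrow> nat list \<Rightarrow> ('f, 'r, 'm) pfm set \<Rightarrow> bool" where
  "consistent M xs p \<longleftrightarrow> (\<exists>bs\<in>tuples M xs. \<forall>(\<phi>, e)\<in>p. sat M (assign e xs bs) \<phi>)"


section \<open>Monster models\<close>

definition finitely_satisfiable ::
  "('f, 'r, 'm) struct \<Rightarrow> nat list \<Rightarrow> ('f, 'r, 'm) pfm set \<Rightarrow> bool" where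
  "finitely_satisfiable M xs p \<longleftrightarrow>
     (\<forall>q\<subseteq>p. finite q \<longrightarrow> (\<exists>bs\<in>tuples M xs. \<forall>(\<phi>, e)\<in>q. sat M (assign e xs bs) \<phi>))"

definition saturated ::
  "'k rel \<Rightarrow> ('f, 'r) lang \<Rightarrow> ('f, 'r, 'm) struct \<Rightarrow> bool" where
  "saturated \<kappa> L M \<longleftrightarrow>
     (\<forall>A xs p. A \<subseteq> dom M \<and> |A| <o \<kappa> \<and> distinct xs \<and> p \<subseteq> over L xs A \<and>
        finitely_satisfiable M xs p \<longrightarrow>
        (\<exists>bs\<in>tuples M xs. \<forall>(\<phi>, e)\<in>p. sat M (assign e xs bs) \<phi>))"

definition partial_elementary ::
  "('f, 'r) lang \<Rightarrow> ('f, 'r, 'm) struct \<Rightarrow> 'm set \<Rightarrow> ('m \<Rightarrow> 'm) \<Rightarrow> bool" where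
  "partial_elementary L M A g \<longleftrightarrow> A \<subseteq> dom M \<and> g ` A \<subseteq> dom M \<and>
     (\<forall>\<phi> e. wf_fm L \<phi> \<and> e ` fv \<phi> \<subseteq> A \<longrightarrow> (sat M e \<phi> \<longleftrightarrow> sat M (g \<circ> e) \<phi>))"

definition automorphism ::
  "('f, 'r) lang \<Rightarrow> ('f, 'r, 'm) struct \<Rightarrow> ('m \<Rightarrow> 'm) \<Rightarrow> bool" where
  "automorphism L M h \<longleftrightarrow> bij_betw h (dom M) (dom M) \<and>
     (\<forall>f\<in>Funs L. \<forall>bs. set bs \<subseteq> dom M \<and> length bs = farity L f \<longrightarrow>
        h (fint M f bs) = fint M f (map h bs)) \<and>
     (\<forall>r\<in>Rels L. \<forall>bs. set bs \<subseteq> dom M \<and> length bs = rarity L r \<longrightarrow>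
        (rint M r bs \<longleftrightarrow> rint M r (map h bs)))"

definition strongly_homogeneous ::
  "'k rel \<Rightarrow> ('f, 'r) lang \<Rightarrow> ('f, 'r, 'm) struct \<Rightarrow> bool" where
  "strongly_homogeneous \<kappa> L M \<longleftrightarrow>
     (\<forall>A g. |A| <o \<kappa> \<and> partial_elementary L M A g \<longrightarrow>
        (\<exists>h. automorphism L M h \<and> (\<forall>a\<in>A. h a = g a)))"

text \<open>There are infinitely many \<open>L\<close>-formulas, so \<open>\<kappa>\<close> is uncountable and larger than the number of
symbols of \<open>L\<close>; \<open>small\<close> means of cardinality less than \<open>\<kappa>\<close>.\<close>

definition monster_model ::
  "'k rel \<Rightarrow> ('f, 'r) lang \<Rightarrow> ('f, 'r) fm set \<Rightarrow> ('f, 'r, 'm) struct \<Rightarrow> bool" where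
  "monster_model \<kappa> L T M \<longleftrightarrow> Card_order \<kappa> \<and> |{\<phi>. wf_fm L \<phi>}| <o \<kappa> \<and>
     model_of L T M \<and> saturated \<kappa> L M \<and> strongly_homogeneous \<kappa> L M"

lemma consistent_iff_finitely:
  assumes "monster_model \<kappa> L T M" "A \<subseteq> dom M" "|A| <o \<kappa>" "distinct xs" "p \<subseteq> over L xs A"
  shows "consistent M xs p \<longleftrightarrow> finitely_satisfiable M xs p"
proof
  show "consistent M xs p \<Longrightarrow> finitely_satisfiable M xs p"
    unfolding consistent_def finitely_satisfiable_def by blast
  show "finitely_satisfiable M xs p \<Longrightarrow> consistent M xs p"
    using assms unfolding monster_model_def saturated_def consistent_def by blast
qed


section \<open>The antichain tree property\<close>

text \<open>The tree of finite 0/1-strings is \<open>bool list\<close>, ordered by \<open>prefix\<close>.\<close>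

definition comparable :: "bool list \<Rightarrow> bool list \<Rightarrow> bool" where
  "comparable \<eta> \<nu> \<longleftrightarrow> prefix \<eta> \<nu> \<or> prefix \<nu> \<eta>"

definition antichain :: "bool list set \<Rightarrow> bool" where
  "antichain A \<longleftrightarrow> (\<forall>\<eta>\<in>A. \<forall>\<nu>\<in>A. \<eta> \<noteq> \<nu> \<longrightarrow> \<not> comparable \<eta> \<nu>)"

text \<open>The partitioned formula \<open>\<phi>(x;y)\<close> is given with its tuples of variables \<open>xs\<close> and \<open>ys\<close>.\<close>

definition partitioned_fm ::
  "('f, 'r) lang \<Rightarrow> ('f, 'r) fm \<Rightarrow> nat list \<Rightarrow> nat list \<Rightarrow> bool" where
  "partitioned_fm L \<phi> xs ys \<longleftrightarrow> wf_fm L \<phi> \<and> distinct (xs @ ys) \<and> fv \<phi> \<subseteq> set (xs @ ys)"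

definition inst ::
  "('f, 'r) fm \<Rightarrow> nat list \<Rightarrow> 'm list \<Rightarrow> ('f, 'r, 'm) pfm" where
  "inst \<phi> ys a = (\<phi>, assign (\<lambda>_. undefined) ys a)"

definition formula_has_k_ATP ::
  "('f, 'r, 'm) struct \<Rightarrow> ('f, 'r) fm \<Rightarrow> nat list \<Rightarrow> nat list \<Rightarrow> nat \<Rightarrow> bool" where
  "formula_has_k_ATP M \<phi> xs ys k \<longleftrightarrow>
     (\<exists>a :: bool list \<Rightarrow> 'm list.
        (\<forall>\<eta>. a \<eta> \<in> tuples M ys) \<and>
        (\<forall>A. antichain A \<longrightarrow> consistent M xs {inst \<phi> ys (a \<eta>) | \<eta>. \<eta> \<in> A}) \<and>
        (\<forall>\<eta> :: nat \<Rightarrow> bool list.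
           inj_on \<eta> {..<k} \<and> (\<forall>i<k. \<forall>j<k. comparable (\<eta> i) (\<eta> j)) \<longrightarrow>
           \<not> consistent M xs {inst \<phi> ys (a (\<eta> i)) | i. i < k}))"

text \<open>As usual, properties of a complete theory are read off from its fixed monster model \<open>M\<close>.\<close>

definition has_k_ATP ::
  "('f, 'r) lang \<Rightarrow> ('f, 'r, 'm) struct \<Rightarrow> nat \<Rightarrow> bool" where
  "has_k_ATP L M k \<longleftrightarrow>
     (\<exists>\<phi> xs ys. partitioned_fm L \<phi> xs ys \<and> formula_has_k_ATP M \<phi> xs ys k)"

abbreviation has_ATP :: "('f, 'r) lang \<Rightarrow> ('f, 'r, 'm) struct \<Rightarrow> bool" where
  "has_ATP L M \<equiv> has_k_ATP L M 2"

end

theory Submission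
  imports Defs "HOL-Library.Countable_Set" "HOL-Library.Nat_Bijection"
begin

text \<open>It suffices to get from \<open>(k+1)\<close>-ATP (\<open>k \<ge> 2\<close>), witnessed by \<open>\<phi>(x;y)\<close> and \<open>(a\<^sub>\<eta>)\<close>, either \<open>k\<close>-ATP or ATP.
Replace every node \<open>\<eta>\<close> of a finite tree by a pair of nodes \<open>\<eta>\<^sub>0 < \<eta>\<^sub>1\<close> such that \<open>\<eta> < \<nu>\<close> implies
\<open>\<eta>\<^sub>1 < \<nu>\<^sub>0\<close>. If, for every finite depth, this can be done so that doubled antichains are consistent,
then \<open>\<phi>(x;y) \<and> \<phi>(x;y')\<close> has \<open>k\<close>-ATP, because a doubled chain of length \<open>k\<close> has more than \<open>k\<close>
elements. Otherwise every such doubling of some finite tree has an antichain \<open>A\<close> whose double is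
inconsistent. Chain pairs satisfy Ramsey's theorem on the tree, so there are ultrafilters of pairs
above each node all of whose members contain all chain pairs of some copy of the tree. A doubling
that is generic for these ultrafilters fixes \<open>A\<close> and yields incomparable copies \<open>H\<^sub>\<eta>\<close>
(\<open>\<eta> \<in> A\<close>) of a finite tree such that \<open>{H\<^sub>\<eta>(\<zeta>), H\<^sub>\<eta>(\<xi>) : \<eta> \<in> A}\<close> is inconsistent whenever
\<open>\<zeta> < \<xi>\<close>; then \<open>\<And>\<^bsub>\<eta>\<in>A\<^esub> \<phi>(x;y\<^sub>\<eta>)\<close> has ATP.\<close>

section \<open>Embeddings and Ramsey's theorem for chain pairs\<close>

definition tree_emb :: "(bool list \<Rightarrow> bool list) \<Rightarrow> bool" where
  "tree_emb h \<longleftrightarrow> (\<forall>\<eta> \<nu>. prefix (h \<eta>) (h \<nu>) \<longleftrightarrow> prefix \<eta> \<nu>)"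

lemma tree_emb_comp: "tree_emb g \<Longrightarrow> tree_emb h \<Longrightarrow> tree_emb (\<lambda>\<eta>. g (h \<eta>))"
  by (simp add: tree_emb_def)

lemma tree_emb_strict: "tree_emb h \<Longrightarrow> strict_prefix (h \<eta>) (h \<nu>) \<longleftrightarrow> strict_prefix \<eta> \<nu>"
  by (metis prefix_order.less_le_not_le tree_emb_def)

lemma tree_emb_comparable: "tree_emb h \<Longrightarrow> comparable (h \<eta>) (h \<nu>) \<longleftrightarrow> comparable \<eta> \<nu>"
  by (simp add: comparable_def tree_emb_def)

lemma tree_emb_append: "tree_emb ((@) \<sigma>)"
  by (simp add: tree_emb_def)

lemma tree_emb_Cons: "tree_emb h \<Longrightarrow> tree_emb (\<lambda>\<eta>. h (b # \<eta>))"
  by (simp add: tree_emb_def)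

lemma comparable_sym: "comparable \<eta> \<nu> \<Longrightarrow> comparable \<nu> \<eta>"
  by (auto simp: comparable_def)

lemma comparable_below:
  assumes "comparable \<eta>' \<nu>'" "prefix \<eta> \<eta>'" "prefix \<nu> \<nu>'"
  shows "comparable \<eta> \<nu>"
  using assms unfolding comparable_def
  by (meson prefix_order.trans prefix_same_cases)

lemma not_comparable_children: "\<not> comparable (\<sigma> @ [False]) (\<sigma> @ [True])"
  by (simp add: comparable_def)

text \<open>A top-down construction of an embedding: the state \<open>s\<close> selects the node \<open>root s\<close>, and all nodes
selected from \<open>s\<close> on lie above \<open>low s\<close>.\<close>

lemma tree_emb_foldl:
  fixes step :: "'s \<Rightarrow> bool \<Rightarrow> 's"
  assumes ok: "\<And>s b. ok s \<Longrightarrow> ok (step s b)"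
    and low: "\<And>s. ok s \<Longrightarrow> prefix (low s) (root s)"
    and below: "\<And>s b. ok s \<Longrightarrow> strict_prefix (root s) (low (step s b))"
    and split: "\<And>s. ok s \<Longrightarrow> \<not> comparable (low (step s False)) (low (step s True))"
    and s: "ok s"
  shows "tree_emb (\<lambda>\<eta>. root (foldl step s \<eta>))"
    and "prefix (low s) (root (foldl step s \<eta>))"
proof -
  have low': "prefix (low s) (root (foldl step s \<eta>))" if "ok s" for s \<eta>
    using that
  proof (induction \<eta> arbitrary: s)
    case (Cons b \<eta>)
    show ?case
      using Cons.IH[OF ok[OF Cons.prems]] low[OF Cons.prems] below[OF Cons.prems, of b]
      by (auto simp: strict_prefix_def intro: prefix_order.trans)
  qed (simp add: low)
  then show "prefix (low s) (root (foldl step s \<eta>))"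
    using s by blast
  have above: "strict_prefix (root s) (root (foldl step s (b # \<eta>)))" if "ok s" for s b \<eta>
    using low'[OF ok[OF that]] below[OF that] by (auto intro: prefix_order.less_le_trans)
  have "prefix (root (foldl step s \<eta>)) (root (foldl step s \<nu>)) \<longleftrightarrow> prefix \<eta> \<nu>" if "ok s" for s \<eta> \<nu>
    using that
  proof (induction \<eta> arbitrary: s \<nu>)
    case Nil
    then show ?case
      using above by (cases \<nu>) (auto simp: strict_prefix_def)
  next
    case (Cons b \<eta>)
    show ?case
    proof (cases \<nu>)
      case Nil
      then show ?thesis
        using above[OF Cons.prems, of b \<eta>] by (auto dest: prefix_order.less_le_not_le[THEN iffD1])
    next
      case (Cons c \<nu>')
      show ?thesis
      proof (cases "b = c")
        case True
        then show ?thesis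
          using Cons Cons.IH[OF ok[OF Cons.prems]] by simp
      next
        case False
        then have "\<not> comparable (low (step s b)) (low (step s c))"
          using split[OF Cons.prems] comparable_sym by (cases b; cases c) auto
        \<comment> \<open>Incomparability of the lower bounds passes to all nodes above
          them.\<close>
        then have "\<not> comparable (root (foldl step (step s b) \<eta>)) (root (foldl step (step s c) \<nu>'))"
          using low'[OF ok[OF Cons.prems]] comparable_below by blast
        then show ?thesis
          using False Cons by (simp add: comparable_def)
      qed
    qed
  qed
  then show "tree_emb (\<lambda>\<eta>. root (foldl step s \<eta>))"
    using s by (simp add: tree_emb_def)
qed

text \<open>Either some cone avoids \<open>D\<close>, and a cone is itself a copy of the tree, or
  \<open>D\<close> is dense and an embedding into \<open>D\<close> can be chosen node by
  node.\<close>

lemma node_ramsey: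
  obtains g where "tree_emb g" "(\<forall>\<eta>. D (g \<eta>)) \<or> (\<forall>\<eta>. \<not> D (g \<eta>))"
proof (cases "\<exists>\<sigma>. \<forall>\<eta>. \<not> D (\<sigma> @ \<eta>)")
  case True
  then show thesis
    using that tree_emb_append by blast
next
  case False
  then have "\<forall>\<sigma>. \<exists>\<eta>. prefix \<sigma> \<eta> \<and> D \<eta>"
    by (auto simp: prefix_def)
  then obtain e where e: "\<And>\<sigma>. prefix \<sigma> (e \<sigma>)" "\<And>\<sigma>. D (e \<sigma>)"
    by metis
  \<comment> \<open>The state is a string \<sigma>; the selected node is its extension
    \<open>e \<sigma>\<close> in \<open>D\<close>, and the two successor states are the children of
    that node.\<close>
  let ?g = "\<lambda>\<eta>. e (foldl (\<lambda>\<sigma> b. e \<sigma> @ [b]) [] \<eta>)"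
  have "tree_emb ?g"
    by (rule tree_emb_foldl[where ok = "\<lambda>_. True" and low = id and root = e])
      (auto simp: e strict_prefix_def not_comparable_children)
  then show thesis
    using that[of ?g] e by blast
qed

text \<open>The root is kept, and everything above it is moved to where the colour of its pair with
  the root is constant. Both branches of the new embedding go into the old \<open>False\<close>
  branch, so one application of \<open>node_ramsey\<close> gives the same colour on both.\<close>

lemma fusion_step:
  assumes h: "tree_emb h"
  shows "\<exists>h' v. tree_emb h' \<and> h' [] = h [] \<and> range h' \<subseteq> range h \<and>
    (\<forall>b \<eta>. c (h []) (h' (b # \<eta>)) = (v :: bool))"
proof -
  obtain g where g: "tree_emb g"
    "(\<forall>\<eta>. c (h []) (h (False # g \<eta>))) \<or> (\<forall>\<eta>. \<not> c (h []) (h (False # g \<eta>)))"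
    using node_ramsey[of "\<lambda>\<eta>. c (h []) (h (False # \<eta>))"] by blast
  define h' where "h' \<eta> = (if \<eta> = [] then h [] else h (False # g \<eta>))" for \<eta>
  have "tree_emb h'"
    using h g(1) unfolding tree_emb_def h'_def by auto
  moreover have "h' [] = h []" "range h' \<subseteq> range h"
    by (auto simp: h'_def)
  moreover have "\<exists>v. \<forall>b \<eta>. c (h []) (h' (b # \<eta>)) = v"
    using g(2) by (auto simp: h'_def)
  ultimately show ?thesis
    by blast
qed

text \<open>By fusion the colour of a pair can be made to depend on its lower node only; this colours
the nodes.\<close>

lemma chain_pair_ramsey:
  obtains g where "tree_emb g"
    "(\<forall>\<eta> \<nu>. strict_prefix \<eta> \<nu> \<longrightarrow> c (g \<eta>) (g \<nu>)) \<or>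
     (\<forall>\<eta> \<nu>. strict_prefix \<eta> \<nu> \<longrightarrow> \<not> c (g \<eta>) (g \<nu>))"
proof -
  obtain st v where st: "\<And>h. tree_emb h \<Longrightarrow> tree_emb (st h)"
    and st_Nil: "\<And>h. tree_emb h \<Longrightarrow> st h [] = h []"
    and st_range: "\<And>h. tree_emb h \<Longrightarrow> range (st h) \<subseteq> range h"
    and st_col: "\<And>h b \<eta>. tree_emb h \<Longrightarrow> c (h []) (st h (b # \<eta>)) = v h"
    using fusion_step[of _ c] by metis
  \<comment> \<open>The state of the fusion is an embedding: \<open>st\<close> makes it homogeneous
    relative to its root, and \<open>step\<close> then passes to the branch at \<open>b\<close>. The
    fused map \<open>G h\<close> sends \<eta> to the root of the state reached along \<eta>.\<close>
  define step where "step h b = (\<lambda>\<eta>. st h (b # \<eta>))" for h b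
  define G where "G h \<eta> = foldl step h \<eta> []" for h \<eta>
  have step: "tree_emb (step h b)" if "tree_emb h" for h b
    using tree_emb_Cons[OF st[OF that]] by (simp add: step_def)
  have emb: "tree_emb (G h)" if "tree_emb h" for h
    unfolding G_def
  proof (rule tree_emb_foldl[where ok = tree_emb and low = "\<lambda>h. h []" and root = "\<lambda>h. h []"])
    fix h b assume h: "tree_emb h"
    show "strict_prefix (h []) (step h b [])"
      using tree_emb_strict[OF st[OF h], of "[]" "[b]"] st_Nil[OF h] by (simp add: step_def)
    show "\<not> comparable (step h False []) (step h True [])"
      using tree_emb_comparable[OF st[OF h], of "[False]" "[True]"]
      by (simp add: step_def comparable_def)
  qed (use that step in auto)
  have G_range: "G h \<eta> \<in> range h" if "tree_emb h" for h \<eta>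
    using that
  proof (induction \<eta> arbitrary: h)
    case (Cons b \<eta>)
    have "G (step h b) \<eta> \<in> range (step h b)"
      using Cons step by blast
    then show ?case
      using st_range[OF Cons.prems] by (auto simp: G_def step_def)
  qed (simp add: G_def)
  \<comment> \<open>All later values lie in the range of \<open>st\<close> of the current state,
    above its root; hence the colour depends only on the state at \<eta>.\<close>
  have col: "c (G h \<eta>) (G h (\<eta> @ b # \<nu>)) = v (foldl step h \<eta>)" if "tree_emb h" for h \<eta> b \<nu>
    using that
  proof (induction \<eta> arbitrary: h)
    case Nil
    have "G (step h b) \<nu> \<in> range (step h b)"
      using Nil step G_range by blast
    then obtain \<zeta> where "G (step h b) \<nu> = st h (b # \<zeta>)"
      by (auto simp: step_def)
    then show ?case
      using st_col[OF Nil] by (simp add: G_def)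
  next
    case (Cons a \<eta>)
    show ?case
      using Cons.IH[OF step[OF Cons.prems]] by (simp add: G_def)
  qed
  have id: "tree_emb id"
    by (simp add: tree_emb_def)
  have col': "c (G id \<eta>) (G id \<nu>) = v (foldl step id \<eta>)" if "strict_prefix \<eta> \<nu>" for \<eta> \<nu>
    using that col[OF id] by (metis strict_prefixE')
  obtain g where g: "tree_emb g"
    "(\<forall>\<eta>. v (foldl step id (g \<eta>))) \<or> (\<forall>\<eta>. \<not> v (foldl step id (g \<eta>)))"
    using node_ramsey[of "\<lambda>\<eta>. v (foldl step id \<eta>)"] by blast
  show thesis
  proof (rule that[of "\<lambda>\<eta>. G id (g \<eta>)"])
    show "tree_emb (\<lambda>\<eta>. G id (g \<eta>))"
      using tree_emb_comp emb[OF id] g(1) by blast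
  qed (use g col' tree_emb_strict[OF g(1)] in auto)
qed

section \<open>Generic doublings\<close>

text \<open>These sets of pairs form the coideal of the Ramsey theorem in the cone above \<sigma>:
  they are upward closed and, by \<open>large_disj\<close>, partition regular.\<close>

definition large :: "bool list \<Rightarrow> (bool list \<times> bool list \<Rightarrow> bool) \<Rightarrow> bool" where
  "large \<sigma> P \<longleftrightarrow> (\<exists>h. tree_emb h \<and> (\<forall>\<eta>. prefix \<sigma> (h \<eta>)) \<and>
     (\<forall>\<eta> \<nu>. strict_prefix \<eta> \<nu> \<longrightarrow> P (h \<eta>, h \<nu>)))"

text \<open>The colouring by \<open>P\<close> is pulled back along the given copy of the tree. A
  homogeneous subcopy either satisfies \<open>P\<close> throughout or avoids it, and in the latter
  case satisfies \<open>Q\<close>.\<close>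

lemma large_disj:
  assumes "large \<sigma> (\<lambda>p. P p \<or> Q p)"
  shows "large \<sigma> P \<or> large \<sigma> Q"
proof -
  obtain h where h: "tree_emb h" "\<And>\<eta>. prefix \<sigma> (h \<eta>)"
    "\<And>\<eta> \<nu>. strict_prefix \<eta> \<nu> \<Longrightarrow> P (h \<eta>, h \<nu>) \<or> Q (h \<eta>, h \<nu>)"
    using assms by (auto simp: large_def)
  obtain g where g: "tree_emb g"
    "(\<forall>\<eta> \<nu>. strict_prefix \<eta> \<nu> \<longrightarrow> P (h (g \<eta>), h (g \<nu>))) \<or>
     (\<forall>\<eta> \<nu>. strict_prefix \<eta> \<nu> \<longrightarrow> \<not> P (h (g \<eta>), h (g \<nu>)))"
    using chain_pair_ramsey[of "\<lambda>x y. P (h x, h y)"] by blast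
  have "tree_emb (\<lambda>\<eta>. h (g \<eta>))"
    using tree_emb_comp h(1) g(1) by blast
  then show ?thesis
    using g h tree_emb_strict[OF g(1)] unfolding large_def by metis
qed

text \<open>Zorn's lemma gives a minimal filter among those with all members in \<open>K\<close>. If
  it decided neither \<open>P\<close> nor its complement, each of these would have a trace outside
  \<open>K\<close> on some member; the two traces cover the intersection of the two members, against
  \<open>disj\<close>.\<close>

lemma ultrafilter_in_coideal:
  fixes K :: "('a \<Rightarrow> bool) \<Rightarrow> bool"
  assumes mono: "\<And>P Q. K P \<Longrightarrow> (\<And>x. P x \<Longrightarrow> Q x) \<Longrightarrow> K Q"
    and disj: "\<And>P Q. K (\<lambda>x. P x \<or> Q x) \<Longrightarrow> K P \<or> K Q"
    and top: "K (\<lambda>_. True)"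
  obtains F where "\<And>P. eventually P F \<Longrightarrow> K P"
    "\<And>P. eventually P F \<or> eventually (\<lambda>x. \<not> P x) F"
proof -
  define S where "S = {F. \<forall>P. eventually P F \<longrightarrow> K P}"
  \<comment> \<open>A smaller filter has more members, so \<open>predicate_Zorn\<close> is applied
    to the reversed order and yields a minimal filter.\<close>
  have "\<exists>F\<in>S. \<forall>G\<in>S. F \<ge> G \<longrightarrow> G = F"
  proof (rule predicate_Zorn)
    show "partial_order_on S (relation_of (\<ge>) S)"
      by (auto simp: partial_order_on_def preorder_on_def refl_on_def trans_def antisym_def
          relation_of_def)
  next
    fix C assume C: "C \<in> Chains (relation_of (\<ge>) S)"
    then have CS: "C \<subseteq> S"
      by (auto simp: Chains_def relation_of_def)
    show "\<exists>u\<in>S. \<forall>F\<in>C. F \<ge> u"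
    proof (cases "C = {}")
      case True
      have "top \<in> S"
        using top by (simp add: S_def eventually_top) (metis mono)
      then show ?thesis
        using True by blast
    next
      case False
      \<comment> \<open>A chain of filters is directed, so its infimum has no members beyond those
        of the filters in it.\<close>
      have "eventually P (Inf C) \<longleftrightarrow> (\<exists>F\<in>C. eventually P F)" for P
      proof (rule eventually_Inf_base[OF False])
        fix F G assume "F \<in> C" "G \<in> C"
        then have "F \<le> G \<or> G \<le> F"
          using C by (auto simp: Chains_def relation_of_def)
        then show "\<exists>x\<in>C. x \<le> inf F G"
          using \<open>F \<in> C\<close> \<open>G \<in> C\<close> by (metis inf.absorb1 inf.absorb2 order_refl)
      qed
      then have "Inf C \<in> S"
        using CS by (auto simp: S_def)
      then show ?thesis
        by (meson Inf_lower)
    qed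
  qed
  then obtain F where F: "F \<in> S" and max: "\<And>G. G \<in> S \<Longrightarrow> G \<le> F \<Longrightarrow> G = F"
    by blast
  \<comment> \<open>By minimality, a set that can be adjoined without leaving \<open>K\<close> is
    already a member.\<close>
  have ult: "eventually P F" if "inf F (principal {x. P x}) \<in> S" for P
  proof -
    have "inf F (principal {x. P x}) = F"
      using max[OF that] by simp
    then have "F \<le> principal {x. P x}"
      by (metis inf.orderI)
    then show ?thesis
      by (simp add: le_principal)
  qed
  have K_ex: "\<exists>Q. eventually Q F \<and> \<not> K (\<lambda>x. Q x \<and> P x)" if P: "inf F (principal {x. P x}) \<notin> S" for P
  proof -
    obtain R where R: "eventually R (inf F (principal {x. P x}))" "\<not> K R"
      using P by (auto simp: S_def)
    then have "eventually (\<lambda>x. P x \<longrightarrow> R x) F"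
      by (simp add: eventually_inf_principal)
    moreover have "\<not> K (\<lambda>x. (P x \<longrightarrow> R x) \<and> P x)"
      using R(2) mono by blast
    ultimately show ?thesis
      by blast
  qed
  have "eventually P F \<or> eventually (\<lambda>x. \<not> P x) F" for P
  proof (rule ccontr)
    assume "\<not> ?thesis"
    then obtain Q R where Q: "eventually Q F" "\<not> K (\<lambda>x. Q x \<and> P x)"
      and R: "eventually R F" "\<not> K (\<lambda>x. R x \<and> \<not> P x)"
      using K_ex[of P] K_ex[of "\<lambda>x. \<not> P x"] ult[of P] ult[of "\<lambda>x. \<not> P x"] by blast
    have "K (\<lambda>x. Q x \<and> R x)"
      using F Q(1) R(1) by (auto simp: S_def intro: eventually_conj)
    then have "K (\<lambda>x. Q x \<and> P x \<or> R x \<and> \<not> P x)"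
      by (rule mono) auto
    from disj[OF this] show False
      using Q(2) R(2) by blast
  qed
  then show thesis
    using that F by (auto simp: S_def)
qed

text \<open>A family of ultrafilters, one for each node. The first clause makes them proper, because
  large sets are nonempty.\<close>

definition generic :: "(bool list \<Rightarrow> (bool list \<times> bool list) filter) \<Rightarrow> bool" where
  "generic V \<longleftrightarrow> (\<forall>\<sigma> P. eventually P (V \<sigma>) \<longrightarrow> large \<sigma> P) \<and>
     (\<forall>\<sigma> P. eventually P (V \<sigma>) \<or> eventually (\<lambda>p. \<not> P p) (V \<sigma>))"

lemma generic_exists: "\<exists>V. generic V"
proof -
  have "\<exists>F. (\<forall>P. eventually P F \<longrightarrow> large \<sigma> P) \<and>
      (\<forall>P. eventually P F \<or> eventually (\<lambda>p. \<not> P p) F)" for \<sigma>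
  proof -
    have "large \<sigma> (\<lambda>_. True)"
      using tree_emb_append[of \<sigma>] by (force simp: large_def)
    moreover have "large \<sigma> Q" if "large \<sigma> P" "\<And>p. P p \<Longrightarrow> Q p" for P Q
      using that unfolding large_def by blast
    ultimately obtain F where "\<And>P. eventually P F \<Longrightarrow> large \<sigma> P"
      "\<And>P. eventually P F \<or> eventually (\<lambda>p. \<not> P p) F"
      using large_disj by (rule_tac ultrafilter_in_coideal[of "large \<sigma>"]) blast+
    then show ?thesis
      by blast
  qed
  then show ?thesis
    unfolding generic_def by metis
qed

text \<open>Every copy of the tree above \<sigma> contains a chain pair, so the complement is not
  large and the ultrafilter has to contain the set itself.\<close>

lemma generic_pair:
  assumes "generic V"
  shows "eventually (\<lambda>p. prefix \<sigma> (fst p) \<and> strict_prefix (fst p) (snd p)) (V \<sigma>)"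
proof -
  have "\<not> large \<sigma> (\<lambda>p. \<not> (prefix \<sigma> (fst p) \<and> strict_prefix (fst p) (snd p)))"
  proof
    assume "large \<sigma> (\<lambda>p. \<not> (prefix \<sigma> (fst p) \<and> strict_prefix (fst p) (snd p)))"
    then obtain h where h: "tree_emb h" "\<And>\<eta>. prefix \<sigma> (h \<eta>)"
      "\<And>\<eta> \<nu>. strict_prefix \<eta> \<nu> \<Longrightarrow> \<not> strict_prefix (h \<eta>) (h \<nu>)"
      by (auto simp: large_def)
    then show False
      using tree_emb_strict[OF h(1), of "[]" "[True]"] by simp
  qed
  then show ?thesis
    using assms unfolding generic_def by meson
qed

lemma generic_ex:
  assumes "generic V" "eventually P (V \<sigma>)"
  shows "\<exists>p. P p"
proof -
  have "large \<sigma> P"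
    using assms by (simp add: generic_def)
  then show ?thesis
    unfolding large_def by (metis strict_prefix_simps(2))
qed

section \<open>Iterated ultrafilter quantifiers over labelled binary trees\<close>

definition join :: "'a \<Rightarrow> (bool list \<Rightarrow> 'a) \<Rightarrow> (bool list \<Rightarrow> 'a) \<Rightarrow> bool list \<Rightarrow> 'a" where
  "join p s t \<eta> = (case \<eta> of [] \<Rightarrow> p | b # \<nu> \<Rightarrow> if b then t \<nu> else s \<nu>)"

lemma join_simps [simp]:
  "join p s t [] = p" "join p s t (True # \<nu>) = t \<nu>" "join p s t (False # \<nu>) = s \<nu>"
  by (simp_all add: join_def)

text \<open>The Fubini product of the ultrafilters along a tree of depth \<open>n\<close>. Both
  subtrees are generic over the children of the upper node of the root label \<open>p\<close>, which
  is what makes the labelling a doubling. Labels at depth \<open>n\<close> or more are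
  \<open>undefined\<close>.\<close>

fun almost_all ::
  "(bool list \<Rightarrow> (bool list \<times> bool list) filter) \<Rightarrow> nat \<Rightarrow> bool list \<Rightarrow>
   ((bool list \<Rightarrow> bool list \<times> bool list) \<Rightarrow> bool) \<Rightarrow> bool" where
  "almost_all V 0 \<sigma> P \<longleftrightarrow> P (\<lambda>_. undefined)"
| "almost_all V (Suc n) \<sigma> P \<longleftrightarrow>
     eventually (\<lambda>p. almost_all V n (snd p @ [False]) (\<lambda>s.
       almost_all V n (snd p @ [True]) (\<lambda>t. P (join p s t)))) (V \<sigma>)"

lemma almost_all_mono:
  "almost_all V n \<sigma> P \<Longrightarrow> (\<And>s. P s \<Longrightarrow> Q s) \<Longrightarrow> almost_all V n \<sigma> Q"
proof (induction n arbitrary: \<sigma> P Q)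
  case (Suc n)
  have "almost_all V n (snd p @ [False]) (\<lambda>s. almost_all V n (snd p @ [True]) (\<lambda>t. Q (join p s t)))"
    if "almost_all V n (snd p @ [False])
      (\<lambda>s. almost_all V n (snd p @ [True]) (\<lambda>t. P (join p s t)))" for p
    using that
  proof (rule Suc.IH)
    fix s assume "almost_all V n (snd p @ [True]) (\<lambda>t. P (join p s t))"
    then show "almost_all V n (snd p @ [True]) (\<lambda>t. Q (join p s t))"
      by (rule Suc.IH) (rule Suc.prems(2))
  qed
  then show ?case
    using Suc.prems(1) by (auto elim!: eventually_mono)
qed simp

lemma almost_all_conj:
  "almost_all V n \<sigma> P \<Longrightarrow> almost_all V n \<sigma> Q \<Longrightarrow> almost_all V n \<sigma> (\<lambda>s. P s \<and> Q s)"
proof (induction n arbitrary: \<sigma> P Q)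
  case (Suc n)
  have "almost_all V n (snd p @ [False])
      (\<lambda>s. almost_all V n (snd p @ [True]) (\<lambda>t. P (join p s t) \<and> Q (join p s t)))"
    if "almost_all V n (snd p @ [False])
      (\<lambda>s. almost_all V n (snd p @ [True]) (\<lambda>t. P (join p s t)))"
      "almost_all V n (snd p @ [False])
      (\<lambda>s. almost_all V n (snd p @ [True]) (\<lambda>t. Q (join p s t)))" for p
    using Suc.IH[OF that] by (rule almost_all_mono) (use Suc.IH in blast)
  then show ?case
    using Suc.prems by (auto elim: eventually_elim2)
qed simp

lemma almost_all_const:
  assumes "generic V"
  shows "almost_all V n \<sigma> (\<lambda>_. b) \<longleftrightarrow> b"
proof (induction n arbitrary: \<sigma>)
  case (Suc n)
  then show ?case
    using generic_ex[OF assms, of "\<lambda>_. b" \<sigma>] by (cases b) auto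
qed simp

lemma almost_all_ball:
  assumes "generic V" "finite X" "\<And>x. x \<in> X \<Longrightarrow> almost_all V n \<sigma> (P x)"
  shows "almost_all V n \<sigma> (\<lambda>s. \<forall>x\<in>X. P x s)"
  using assms(2,3)
proof (induction X rule: finite_induct)
  case empty
  then show ?case
    using almost_all_const[OF assms(1), of n \<sigma> True] by simp
next
  case (insert x X)
  then show ?case
    using almost_all_conj[of V n \<sigma> "P x" "\<lambda>s. \<forall>x\<in>X. P x s"] by simp
qed

lemma almost_all_ex:
  assumes "generic V" "almost_all V n \<sigma> P"
  shows "\<exists>s. P s"
proof (rule ccontr)
  assume "\<not> ?thesis"
  then have "almost_all V n \<sigma> (\<lambda>_. False)"
    using almost_all_mono[OF assms(2)] by blast
  then show False
    by (simp add: almost_all_const[OF assms(1)])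
qed

text \<open>The product inherits the ultrafilter dichotomy level by level.\<close>

lemma almost_all_not:
  assumes "generic V"
  shows "\<not> almost_all V n \<sigma> P \<Longrightarrow> almost_all V n \<sigma> (\<lambda>s. \<not> P s)"
proof (induction n arbitrary: \<sigma> P)
  case (Suc n)
  have "eventually (\<lambda>p. \<not> almost_all V n (snd p @ [False])
      (\<lambda>s. almost_all V n (snd p @ [True]) (\<lambda>t. P (join p s t)))) (V \<sigma>)"
    using Suc.prems assms by (auto simp: generic_def)
  then show ?case
    unfolding almost_all.simps
  proof (rule eventually_mono)
    fix p assume "\<not> almost_all V n (snd p @ [False])
      (\<lambda>s. almost_all V n (snd p @ [True]) (\<lambda>t. P (join p s t)))"
    then have "almost_all V n (snd p @ [False])
      (\<lambda>s. \<not> almost_all V n (snd p @ [True]) (\<lambda>t. P (join p s t)))"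
      by (rule Suc.IH)
    then show "almost_all V n (snd p @ [False])
      (\<lambda>s. almost_all V n (snd p @ [True]) (\<lambda>t. \<not> P (join p s t)))"
      by (rule almost_all_mono) (rule Suc.IH)
  qed
qed simp

section \<open>Almost all labellings are doublings\<close>

definition doubling :: "nat \<Rightarrow> bool list \<Rightarrow> (bool list \<Rightarrow> bool list \<times> bool list) \<Rightarrow> bool" where
  "doubling n \<sigma> s \<longleftrightarrow> (\<forall>\<eta>. length \<eta> < n \<longrightarrow>
     prefix \<sigma> (fst (s \<eta>)) \<and> strict_prefix (fst (s \<eta>)) (snd (s \<eta>)) \<and>
     (\<forall>\<nu>. length \<nu> < n \<longrightarrow> strict_prefix \<eta> \<nu> \<longrightarrow> strict_prefix (snd (s \<eta>)) (fst (s \<nu>))))"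

lemma doubling_join:
  assumes "prefix \<sigma> (fst p)" "strict_prefix (fst p) (snd p)"
    and s: "doubling n (snd p @ [False]) s" and t: "doubling n (snd p @ [True]) t"
  shows "doubling (Suc n) \<sigma> (join p s t)"
proof -
  have up: "strict_prefix (snd p) (fst (join p s t (b # \<eta>)))"
    "strict_prefix (fst (join p s t (b # \<eta>))) (snd (join p s t (b # \<eta>)))" if "length \<eta> < n" for b \<eta>
  proof -
    have "prefix (snd p @ [b]) (fst (join p s t (b # \<eta>)))"
      using s t that by (cases b) (auto simp: doubling_def)
    then show "strict_prefix (snd p) (fst (join p s t (b # \<eta>)))"
      by (auto simp: strict_prefix_def prefix_def)
    show "strict_prefix (fst (join p s t (b # \<eta>))) (snd (join p s t (b # \<eta>)))"
      using s t that by (cases b) (auto simp: doubling_def)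
  qed
  have *: "strict_prefix (snd (join p s t (b # \<eta>))) (fst (join p s t (b # \<nu>)))"
    if "length \<eta> < n" "length \<nu> < n" "strict_prefix \<eta> \<nu>" for b \<eta> \<nu>
    using s t that by (cases b) (auto simp: doubling_def)
  have **: "prefix \<sigma> (fst (join p s t \<eta>))" if "length \<eta> < Suc n" for \<eta>
    using that assms(1,2) up
    by (cases \<eta>) (auto simp: strict_prefix_def intro: prefix_order.trans)
  show ?thesis
    unfolding doubling_def
  proof (intro allI impI conjI)
    fix \<eta> :: "bool list" assume \<eta>: "length \<eta> < Suc n"
    then show "prefix \<sigma> (fst (join p s t \<eta>))"
      by (rule **)
    show "strict_prefix (fst (join p s t \<eta>)) (snd (join p s t \<eta>))"
      using assms(2) up(2) \<eta> by (cases \<eta>) simp_all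
    fix \<nu> :: "bool list" assume \<nu>: "length \<nu> < Suc n" "strict_prefix \<eta> \<nu>"
    obtain b \<nu>' where [simp]: "\<nu> = b # \<nu>'"
      using \<nu>(2) by (cases \<nu>) auto
    show "strict_prefix (snd (join p s t \<eta>)) (fst (join p s t \<nu>))"
    proof (cases \<eta>)
      case Nil
      then show ?thesis
        using up(1)[of \<nu>' b] \<nu>(1) by simp
    next
      case (Cons a \<eta>')
      then show ?thesis
        using *[of \<eta>' \<nu>' b] \<nu> \<eta> by simp
    qed
  qed
qed

lemma almost_all_doubling:
  assumes "generic V"
  shows "almost_all V n \<sigma> (doubling n \<sigma>)"
proof (induction n arbitrary: \<sigma>)
  case (Suc n)
  show ?case
    unfolding almost_all.simps using generic_pair[OF assms, of \<sigma>]
  proof (rule eventually_mono)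
    fix p assume p: "prefix \<sigma> (fst p) \<and> strict_prefix (fst p) (snd p)"
    show "almost_all V n (snd p @ [False])
      (\<lambda>s. almost_all V n (snd p @ [True]) (\<lambda>t. doubling (Suc n) \<sigma> (join p s t)))"
      using Suc.IH
    proof (rule almost_all_mono)
      fix s assume s: "doubling n (snd p @ [False]) s"
      show "almost_all V n (snd p @ [True]) (\<lambda>t. doubling (Suc n) \<sigma> (join p s t))"
        using Suc.IH by (rule almost_all_mono) (use doubling_join p s in blast)
    qed
  qed
qed (simp add: doubling_def)

section \<open>Chain pairs in pairwise incomparable copies of the tree\<close>

definition grid :: "nat \<Rightarrow> bool list set \<Rightarrow> (bool list \<Rightarrow> bool list \<Rightarrow> bool list) \<Rightarrow>
    (bool list \<Rightarrow> bool list \<times> bool list) \<Rightarrow> bool" where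
  "grid N A H s \<longleftrightarrow> (\<forall>\<eta>\<in>A. \<exists>\<zeta> \<xi>. length \<xi> < N \<and> strict_prefix \<zeta> \<xi> \<and>
     s \<eta> = (H \<eta> \<zeta>, H \<eta> \<xi>))"

lemma finite_strings: "finite {\<eta> :: bool list. length \<eta> < n}"
  using finite_lists_length_le[of "UNIV :: bool set" n]
  by (rule finite_subset[rotated]) auto

text \<open>The bound \<open>N\<close> leaves finitely many pairs in each copy, and the labels
  outside \<open>A\<close> are normalized to \<open>d\<close>. Finiteness allows a conjunction over
  all grids in \<open>almost_all_grid\<close>.\<close>

lemma finite_grid_restrict:
  assumes "finite A"
  shows "finite {s. grid N A H s \<and> (\<forall>\<eta>. \<eta> \<notin> A \<longrightarrow> s \<eta> = d)}"
proof (rule finite_subset)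
  let ?X = "{\<eta> :: bool list. length \<eta> < N}"
  let ?Y = "(\<Union>\<eta>\<in>A. H \<eta> ` ?X) \<times> (\<Union>\<eta>\<in>A. H \<eta> ` ?X)"
  show "finite {s. \<forall>\<eta>. (\<eta> \<in> A \<longrightarrow> s \<eta> \<in> ?Y) \<and> (\<eta> \<notin> A \<longrightarrow> s \<eta> = d)}"
    using assms finite_strings by (intro finite_set_of_finite_funs) auto
  show "{s. grid N A H s \<and> (\<forall>\<eta>. \<eta> \<notin> A \<longrightarrow> s \<eta> = d)} \<subseteq>
      {s. \<forall>\<eta>. (\<eta> \<in> A \<longrightarrow> s \<eta> \<in> ?Y) \<and> (\<eta> \<notin> A \<longrightarrow> s \<eta> = d)}"
  proof (intro subsetI CollectI allI conjI impI)
    fix s \<eta>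
    assume s: "s \<in> {s. grid N A H s \<and> (\<forall>\<eta>. \<eta> \<notin> A \<longrightarrow> s \<eta> = d)}"
    show "s \<eta> = d" if "\<eta> \<notin> A"
      using s that by simp
    assume \<eta>: "\<eta> \<in> A"
    obtain \<zeta> \<xi> where z: "length \<xi> < N" "strict_prefix \<zeta> \<xi>" "s \<eta> = (H \<eta> \<zeta>, H \<eta> \<xi>)"
      using s \<eta> by (auto simp: grid_def)
    then have "length \<zeta> < N"
      by (meson order.strict_trans prefix_length_less)
    then show "s \<eta> \<in> ?Y"
      using z \<eta> by auto
  qed
qed

lemma antichain_Cons:
  "antichain A \<Longrightarrow> antichain {\<eta>. b # \<eta> \<in> A}"
  by (fastforce simp: antichain_def comparable_def)

lemma antichain_subset: "antichain A \<Longrightarrow> B \<subseteq> A \<Longrightarrow> antichain B"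
  by (auto simp: antichain_def)

definition spread :: "bool list \<Rightarrow> bool list set \<Rightarrow> (bool list \<Rightarrow> bool list \<Rightarrow> bool list) \<Rightarrow> bool" where
  "spread \<sigma> A H \<longleftrightarrow> (\<forall>\<eta>\<in>A. tree_emb (H \<eta>) \<and> (\<forall>\<zeta>. prefix \<sigma> (H \<eta> \<zeta>))) \<and>
     (\<forall>\<eta>\<in>A. \<forall>\<nu>\<in>A. \<eta> \<noteq> \<nu> \<longrightarrow> (\<forall>\<zeta> \<xi>. \<not> comparable (H \<eta> \<zeta>) (H \<nu> \<xi>)))"

text \<open>Copies from different halves lie above different children of \<sigma> and are therefore
  incomparable. \<open>G\<close> is a placeholder for the root, which lies outside
  \<open>A\<close>.\<close>

lemma spread_join:
  assumes H: "spread (\<sigma> @ [False]) {\<eta>. False # \<eta> \<in> A} H"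
    and K: "spread (\<sigma> @ [True]) {\<eta>. True # \<eta> \<in> A} K"
    and "[] \<notin> A" "prefix \<tau> \<sigma>"
  shows "spread \<tau> A (join G H K)"
proof -
  have cross: "\<not> comparable (H \<eta> \<zeta>) (K \<nu> \<xi>)" if "False # \<eta> \<in> A" "True # \<nu> \<in> A" for \<eta> \<nu> \<zeta> \<xi>
  proof
    assume "comparable (H \<eta> \<zeta>) (K \<nu> \<xi>)"
    then have "comparable (\<sigma> @ [False]) (\<sigma> @ [True])"
      by (rule comparable_below) (use H K that in \<open>auto simp: spread_def\<close>)
    then show False
      using not_comparable_children by blast
  qed
  have ab: "tree_emb (join G H K \<eta>) \<and> (\<forall>\<zeta>. prefix \<tau> (join G H K \<eta> \<zeta>))" if "\<eta> \<in> A" for \<eta>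
  proof (cases \<eta>)
    case Nil
    then show ?thesis
      using that assms(3) by blast
  next
    case (Cons b \<eta>')
    have "prefix \<tau> (\<sigma> @ [b])"
      using assms(4) by (auto simp: prefix_def)
    moreover have "tree_emb (join G H K \<eta>) \<and> (\<forall>\<zeta>. prefix (\<sigma> @ [b]) (join G H K \<eta> \<zeta>))"
      using H K that Cons by (cases b) (simp_all add: spread_def)
    ultimately show ?thesis
      using prefix_order.trans by blast
  qed
  have sep: "\<not> comparable (join G H K \<eta> \<zeta>) (join G H K \<nu> \<xi>)"
    if ne: "\<eta> \<in> A" "\<nu> \<in> A" "\<eta> \<noteq> \<nu>" for \<eta> \<nu> \<zeta> \<xi>
  proof -
    obtain a \<eta>' b \<nu>' where [simp]: "\<eta> = a # \<eta>'" "\<nu> = b # \<nu>'"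
      using ne assms(3) by (cases \<eta>; cases \<nu>) auto
    show ?thesis
    proof (cases "a = b")
      case True
      then show ?thesis
        using H K ne by (cases b) (simp_all add: spread_def)
    next
      case False
      then show ?thesis
        using ne cross[of \<eta>' \<nu>' \<zeta> \<xi>] cross[of \<nu>' \<eta>' \<xi> \<zeta>] comparable_sym
        by (cases a; cases b) auto
    qed
  qed
  show ?thesis
    using ab sep by (simp add: spread_def)
qed

text \<open>Induction on the depth. If the root lies in \<open>A\<close>, then \<open>A\<close> is
  just the root, and largeness yields the copy. Otherwise a root label is fixed, the left half of
  \<open>A\<close> gets its copies first, and those for the right half are chosen to suit the
  finitely many left grids simultaneously. Thus the pairs in different copies may be combined
  freely.\<close>

lemma almost_all_grid:
  assumes V: "generic V"
    and "antichain A" "\<And>\<eta>. \<eta> \<in> A \<Longrightarrow> length \<eta> < n"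
    and "\<And>s t. (\<And>\<eta>. \<eta> \<in> A \<Longrightarrow> s \<eta> = t \<eta>) \<Longrightarrow> P s \<longleftrightarrow> P t"
    and "almost_all V n \<sigma> P"
  shows "\<exists>H. spread \<sigma> A H \<and> (\<forall>s. grid N A H s \<longrightarrow> P s)"
  using assms(2-)
proof (induction n arbitrary: \<sigma> A P)
  case 0
  have "A = {}"
    using "0.prems"(2) by auto
  moreover have "P s" for s
    using "0.prems"(3)[of s "\<lambda>_. undefined"] "0.prems"(4) \<open>A = {}\<close> by simp
  ultimately show ?case
    by (simp add: spread_def)
next
  case (Suc n)
  let ?Q = "\<lambda>p. almost_all V n (snd p @ [False]) (\<lambda>s. almost_all V n (snd p @ [True])
    (\<lambda>t. P (join p s t)))"
  have ev: "eventually ?Q (V \<sigma>)"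
    using Suc.prems(4) by simp
  show ?case
  proof (cases "[] \<in> A")
    case True
    have A: "A = {[]}"
      using True Suc.prems(1) by (fastforce simp: antichain_def comparable_def)
    have "P (\<lambda>_. p)" if p: "?Q p" for p
    proof -
      obtain s where "almost_all V n (snd p @ [True]) (\<lambda>t. P (join p s t))"
        using almost_all_ex[OF V p] by blast
      then obtain t where "P (join p s t)"
        using almost_all_ex[OF V] by blast
      then show ?thesis
        using Suc.prems(3)[of "join p s t" "\<lambda>_. p"] A by simp
    qed
    then have "eventually (\<lambda>p. P (\<lambda>_. p)) (V \<sigma>)"
      using ev by (auto elim: eventually_mono)
    then have "large \<sigma> (\<lambda>p. P (\<lambda>_. p))"
      using V by (simp add: generic_def)
    then obtain h where h: "tree_emb h" "\<And>\<eta>. prefix \<sigma> (h \<eta>)"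
      "\<And>\<eta> \<nu>. strict_prefix \<eta> \<nu> \<Longrightarrow> P (\<lambda>_. (h \<eta>, h \<nu>))"
      by (auto simp: large_def)
    have "P s" if s: "grid N A (\<lambda>_. h) s" for s
    proof -
      obtain \<zeta> \<xi> where "strict_prefix \<zeta> \<xi>" "s [] = (h \<zeta>, h \<xi>)"
        using s A by (auto simp: grid_def)
      then show ?thesis
        using h(3) Suc.prems(3)[of s "\<lambda>_. s []"] A by simp
    qed
    then show ?thesis
      using h A by (intro exI[of _ "\<lambda>_. h"]) (auto simp: spread_def)
  next
    case False
    \<comment> \<open>\<open>P\<close> does not see the label of the root here, so one generic value
      of it is enough.\<close>
    obtain p where p: "prefix \<sigma> (snd p)" "?Q p"
    proof -
      obtain p where "?Q p \<and> prefix \<sigma> (fst p) \<and> strict_prefix (fst p) (snd p)"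
        using generic_ex[OF V eventually_conj[OF ev generic_pair[OF V, of \<sigma>]]] by blast
      then show thesis
        using that[of p] prefix_order.trans[of \<sigma> "fst p" "snd p"] by (simp add: strict_prefix_def)
    qed
    let ?A = "\<lambda>b. {\<eta>. b # \<eta> \<in> A}"
    have A: "antichain (?A b)" "\<And>\<eta>. \<eta> \<in> ?A b \<Longrightarrow> length \<eta> < n" for b
      using antichain_Cons[OF Suc.prems(1)] Suc.prems(2) by fastforce+
    have join_cong: "P (join p s t) \<longleftrightarrow> P (join p s' t')"
      if "\<And>\<eta>. \<eta> \<in> ?A False \<Longrightarrow> s \<eta> = s' \<eta>" "\<And>\<eta>. \<eta> \<in> ?A True \<Longrightarrow> t \<eta> = t' \<eta>" for s t s' t'
    proof (rule Suc.prems(3))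
      fix \<eta> assume "\<eta> \<in> A"
      then show "join p s t \<eta> = join p s' t' \<eta>"
        using that False by (cases \<eta>) (auto simp: join_def)
    qed
    have "\<exists>H. spread (snd p @ [False]) (?A False) H \<and> (\<forall>s. grid N (?A False) H s \<longrightarrow>
        almost_all V n (snd p @ [True]) (\<lambda>t. P (join p s t)))"
    proof (rule Suc.IH[OF A _ p(2)])
      fix s s' :: "bool list \<Rightarrow> bool list \<times> bool list"
      assume "\<And>\<eta>. \<eta> \<in> ?A False \<Longrightarrow> s \<eta> = s' \<eta>"
      then have "(\<lambda>t. P (join p s t)) = (\<lambda>t. P (join p s' t))"
        using join_cong by blast
      then show "almost_all V n (snd p @ [True]) (\<lambda>t. P (join p s t)) \<longleftrightarrow>
          almost_all V n (snd p @ [True]) (\<lambda>t. P (join p s' t))"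
        by simp
    qed
    then obtain H where H: "spread (snd p @ [False]) (?A False) H"
      "\<And>s. grid N (?A False) H s \<Longrightarrow> almost_all V n (snd p @ [True]) (\<lambda>t. P (join p s t))"
      by blast
    \<comment> \<open>Representatives of the left grids: \<open>P\<close> depends only on labels in
      \<open>A\<close>, so fixing the others loses nothing and leaves a finite set.\<close>
    let ?S = "{s. grid N (?A False) H s \<and> (\<forall>\<eta>. \<eta> \<notin> ?A False \<longrightarrow> s \<eta> = undefined)}"
    have "finite (?A False)"
      using A(2) finite_strings by (rule_tac finite_subset[of _ "{\<eta>. length \<eta> < n}"]) auto
    then have aa: "almost_all V n (snd p @ [True]) (\<lambda>t. \<forall>s\<in>?S. P (join p s t))"
      by (intro almost_all_ball[OF V] finite_grid_restrict H(2)) auto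
    have "\<exists>K. spread (snd p @ [True]) (?A True) K \<and> (\<forall>t. grid N (?A True) K t \<longrightarrow>
        (\<forall>s\<in>?S. P (join p s t)))"
    proof (rule Suc.IH[OF A _ aa])
      fix t t' :: "bool list \<Rightarrow> bool list \<times> bool list"
      assume "\<And>\<eta>. \<eta> \<in> ?A True \<Longrightarrow> t \<eta> = t' \<eta>"
      then show "(\<forall>s\<in>?S. P (join p s t)) \<longleftrightarrow> (\<forall>s\<in>?S. P (join p s t'))"
        using join_cong by blast
    qed
    then obtain K where K: "spread (snd p @ [True]) (?A True) K"
      "\<And>s t. grid N (?A True) K t \<Longrightarrow> s \<in> ?S \<Longrightarrow> P (join p s t)"
      by blast
    \<comment> \<open>Such an \<open>s\<close> splits into its left half, normalized to lie in
      \<open>?S\<close>, and its right half.\<close>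
    have "P s" if s: "grid N A (join undefined H K) s" for s
    proof -
      let ?s = "\<lambda>\<eta>. if \<eta> \<in> ?A False then s (False # \<eta>) else undefined"
      have K': "grid N (?A True) K (\<lambda>\<eta>. s (True # \<eta>))"
        unfolding grid_def
      proof
        fix \<eta> assume "\<eta> \<in> ?A True"
        then show "\<exists>\<zeta> \<xi>. length \<xi> < N \<and> strict_prefix \<zeta> \<xi> \<and> s (True # \<eta>) = (K \<eta> \<zeta>, K \<eta> \<xi>)"
          using s[unfolded grid_def, rule_format, of "True # \<eta>"] by simp
      qed
      have "\<exists>\<zeta> \<xi>. length \<xi> < N \<and> strict_prefix \<zeta> \<xi> \<and> s (False # \<eta>) = (H \<eta> \<zeta>, H \<eta> \<xi>)"
        if "\<eta> \<in> ?A False" for \<eta>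
        using s[unfolded grid_def, rule_format, of "False # \<eta>"] that by simp
      then have "?s \<in> ?S"
        by (simp add: grid_def)
      then have "P (join p ?s (\<lambda>\<eta>. s (True # \<eta>)))"
        using K(2) K' by blast
      moreover have "join p ?s (\<lambda>\<eta>. s (True # \<eta>)) \<eta> = s \<eta>" if "\<eta> \<in> A" for \<eta>
        using that False by (cases \<eta>) (auto simp: join_def)
      ultimately show ?thesis
        using Suc.prems(3) by blast
    qed
    then show ?thesis
      using spread_join[OF H(1) K(1) False p(1)] by blast
  qed
qed

definition doubled :: "(bool list \<Rightarrow> bool list \<times> bool list) \<Rightarrow> bool list set \<Rightarrow> bool list set" where
  "doubled s A = fst ` s ` A \<union> snd ` s ` A"

text \<open>There are finitely many antichains below depth \<open>n\<close>. Either almost all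
  labellings satisfy \<open>C\<close> on each of them, or by the dichotomy almost all violate it on
  a fixed \<open>A\<close>. This \<open>A\<close> is found before \<open>N\<close>, so that one
  formula can later serve all depths.\<close>

theorem doubling_or_grid:
  fixes C :: "bool list set \<Rightarrow> bool"
  shows "(\<exists>s. doubling n [] s \<and> (\<forall>A. antichain A \<and> (\<forall>\<eta>\<in>A. length \<eta> < n) \<longrightarrow> C (doubled s A))) \<or>
    (\<exists>A. finite A \<and> (\<forall>N. \<exists>H. spread [] A H \<and>
       (\<forall>s. grid N A H s \<longrightarrow> \<not> C (doubled s A))))"
proof -
  obtain V where V: "generic V"
    using generic_exists by blast
  let ?\<A> = "{A. antichain A \<and> (\<forall>\<eta>\<in>A. length \<eta> < n)}"
  have fin: "finite ?\<A>"
    by (rule finite_subset[of _ "Pow {\<eta>. length \<eta> < n}"]) (use finite_strings in auto)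
  show ?thesis
  proof (cases "\<forall>A\<in>?\<A>. almost_all V n [] (\<lambda>s. C (doubled s A))")
    case True
    then have "almost_all V n [] (\<lambda>s. \<forall>A\<in>?\<A>. C (doubled s A))"
      using almost_all_ball[OF V fin, of n "[]" "\<lambda>A s. C (doubled s A)"] by blast
    then have "almost_all V n [] (\<lambda>s. doubling n [] s \<and> (\<forall>A\<in>?\<A>. C (doubled s A)))"
      using almost_all_conj almost_all_doubling[OF V] by blast
    then have "\<exists>s. doubling n [] s \<and> (\<forall>A\<in>?\<A>. C (doubled s A))"
      by (rule almost_all_ex[OF V])
    then show ?thesis
      by simp
  next
    case False
    then obtain A where A: "antichain A" "\<And>\<eta>. \<eta> \<in> A \<Longrightarrow> length \<eta> < n"
      and bad: "almost_all V n [] (\<lambda>s. \<not> C (doubled s A))"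
      using almost_all_not[OF V] by blast
    have "\<exists>H. spread [] A H \<and> (\<forall>s. grid N A H s \<longrightarrow> \<not> C (doubled s A))" for N
    proof (rule almost_all_grid[OF V A _ bad])
      fix s t :: "bool list \<Rightarrow> bool list \<times> bool list"
      assume "\<And>\<eta>. \<eta> \<in> A \<Longrightarrow> s \<eta> = t \<eta>"
      then have "s ` A = t ` A"
        by (rule image_cong[OF refl])
      then show "(\<not> C (doubled s A)) \<longleftrightarrow> (\<not> C (doubled t A))"
        by (simp add: doubled_def)
    qed
    moreover have "finite A"
      using A(2) by (rule_tac finite_subset[OF _ finite_strings[of n]]) auto
    ultimately show ?thesis
      by blast
  qed
qed

section \<open>Renaming, conjunctions and realization of types\<close>

fun ren_tm :: "(nat \<Rightarrow> nat) \<Rightarrow> 'f tm \<Rightarrow> 'f tm" where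
  "ren_tm \<pi> (Var v) = Var (\<pi> v)"
| "ren_tm \<pi> (Fn f ts) = Fn f (map (ren_tm \<pi>) ts)"

fun ren :: "(nat \<Rightarrow> nat) \<Rightarrow> ('f, 'r) fm \<Rightarrow> ('f, 'r) fm" where
  "ren \<pi> (Eq s t) = Eq (ren_tm \<pi> s) (ren_tm \<pi> t)"
| "ren \<pi> (Rl r ts) = Rl r (map (ren_tm \<pi>) ts)"
| "ren \<pi> (Neg \<phi>) = Neg (ren \<pi> \<phi>)"
| "ren \<pi> (And \<phi> \<psi>) = And (ren \<pi> \<phi>) (ren \<pi> \<psi>)"
| "ren \<pi> (Ex v \<phi>) = Ex (\<pi> v) (ren \<pi> \<phi>)"

lemma tm_val_ren: "tm_val M e (ren_tm \<pi> t) = tm_val M (e \<circ> \<pi>) t"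
  by (induction t) (auto intro: arg_cong[where f = "fint M _"])

text \<open>Injectivity keeps a renamed bound variable from capturing a free one.\<close>

lemma sat_ren: "inj \<pi> \<Longrightarrow> sat M e (ren \<pi> \<phi>) \<longleftrightarrow> sat M (e \<circ> \<pi>) \<phi>"
proof (induction \<phi> arbitrary: e)
  case (Rl r ts)
  have "map (tm_val M e) (map (ren_tm \<pi>) ts) = map (tm_val M (e \<circ> \<pi>)) ts"
    by (simp add: tm_val_ren)
  then show ?case
    by (simp only: ren.simps sat.simps)
next
  case (Ex v \<phi>)
  have "(e(\<pi> v := b)) \<circ> \<pi> = (e \<circ> \<pi>)(v := b)" for b
    using Ex.prems by (auto simp: fun_eq_iff inj_eq)
  then show ?case
    by (simp only: ren.simps sat.simps Ex.IH[OF Ex.prems])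
qed (simp_all add: tm_val_ren)

lemma fv_ren_tm: "fv_tm (ren_tm \<pi> t) = \<pi> ` fv_tm t"
  by (induction t) auto

lemma fv_ren: "inj \<pi> \<Longrightarrow> fv (ren \<pi> \<phi>) = \<pi> ` fv \<phi>"
  by (induction \<phi>) (auto simp: fv_ren_tm image_set_diff)

lemma wf_ren_tm: "wf_tm L t \<Longrightarrow> wf_tm L (ren_tm \<pi> t)"
  by (induction t) auto

lemma wf_ren: "wf_fm L \<phi> \<Longrightarrow> wf_fm L (ren \<pi> \<phi>)"
  by (induction \<phi>) (auto simp: wf_ren_tm)

lemma tm_val_cong: "(\<And>v. v \<in> fv_tm t \<Longrightarrow> e v = e' v) \<Longrightarrow> tm_val M e t = tm_val M e' t"
proof (induction t)
  case (Fn f ts)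
  then have "map (tm_val M e) ts = map (tm_val M e') ts"
    by auto
  then show ?case
    by (simp only: tm_val.simps)
qed simp

lemma sat_cong: "(\<And>v. v \<in> fv \<phi> \<Longrightarrow> e v = e' v) \<Longrightarrow> sat M e \<phi> \<longleftrightarrow> sat M e' \<phi>"
proof (induction \<phi> arbitrary: e e')
  case (Eq s t)
  then show ?case
    using tm_val_cong[of s e e' M] tm_val_cong[of t e e' M] by simp
next
  case (Rl r ts)
  then have "map (tm_val M e) ts = map (tm_val M e') ts"
    by (intro map_cong tm_val_cong refl) auto
  then show ?case
    by (simp only: sat.simps)
next
  case (Neg \<phi>)
  have "sat M e \<phi> \<longleftrightarrow> sat M e' \<phi>"
    by (rule Neg.IH) (simp add: Neg.prems)
  then show ?case
    by simp
next
  case (And \<phi> \<psi>)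
  have "sat M e \<phi> \<longleftrightarrow> sat M e' \<phi>" "sat M e \<psi> \<longleftrightarrow> sat M e' \<psi>"
    using And.prems by (auto intro!: And.IH)
  then show ?case
    by simp
next
  case (Ex v \<phi>)
  have "sat M (e(v := b)) \<phi> \<longleftrightarrow> sat M (e'(v := b)) \<phi>" for b
    using Ex.prems by (intro Ex.IH) auto
  then show ?case
    by simp
qed

lemma finite_fv_tm: "finite (fv_tm t)"
  by (induction t) auto

lemma finite_fv: "finite (fv \<phi>)"
  by (induction \<phi>) (auto simp: finite_fv_tm)

text \<open>The empty conjunction is a sentence without symbols of the language that holds in every
  structure with nonempty domain; formulas have no constant for truth.\<close>

definition Ands :: "('f, 'r) fm list \<Rightarrow> ('f, 'r) fm" where
  "Ands \<phi>s = foldr And \<phi>s (Ex 0 (Eq (Var 0) (Var 0)))"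

definition Exs :: "nat list \<Rightarrow> ('f, 'r) fm \<Rightarrow> ('f, 'r) fm" where
  "Exs = foldr Ex"

lemma sat_Ands: "dom M \<noteq> {} \<Longrightarrow> sat M e (Ands \<phi>s) \<longleftrightarrow> (\<forall>\<phi>\<in>set \<phi>s. sat M e \<phi>)"
  by (induction \<phi>s) (auto simp: Ands_def)

lemma fv_Ands: "fv (Ands \<phi>s) = \<Union> (fv ` set \<phi>s)"
  by (induction \<phi>s) (auto simp: Ands_def)

lemma wf_Ands: "wf_fm L (Ands \<phi>s) \<longleftrightarrow> (\<forall>\<phi>\<in>set \<phi>s. wf_fm L \<phi>)"
  by (induction \<phi>s) (auto simp: Ands_def)

lemma fv_Exs: "fv (Exs vs \<phi>) = fv \<phi> - set vs"
  by (induction vs) (auto simp: Exs_def)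

lemma wf_Exs: "wf_fm L (Exs vs \<phi>) \<longleftrightarrow> wf_fm L \<phi>"
  by (induction vs) (auto simp: Exs_def)

lemma sat_Exs:
  "sat M e (Exs vs \<phi>) \<longleftrightarrow>
     (\<exists>e'. (\<forall>v. v \<notin> set vs \<longrightarrow> e' v = e v) \<and> e' ` set vs \<subseteq> dom M \<and> sat M e' \<phi>)"
proof (induction vs arbitrary: e)
  case Nil
  have "(\<exists>e'. (\<forall>v. e' v = e v) \<and> sat M e' \<phi>) \<longleftrightarrow> sat M e \<phi>"
    by (metis ext)
  then show ?case
    by (simp add: Exs_def)
next
  case (Cons w vs)
  have "sat M e (Exs (w # vs) \<phi>) \<longleftrightarrow> (\<exists>b\<in>dom M. \<exists>e'. (\<forall>v. v \<notin> set vs \<longrightarrow> e' v = (e(w := b)) v) \<and>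
      e' ` set vs \<subseteq> dom M \<and> sat M e' \<phi>)"
    using Cons.IH by (simp add: Exs_def)
  also have "\<dots> \<longleftrightarrow> (\<exists>e'. (\<forall>v. v \<notin> set (w # vs) \<longrightarrow> e' v = e v) \<and>
      e' ` set (w # vs) \<subseteq> dom M \<and> sat M e' \<phi>)" (is "?L \<longleftrightarrow> ?R")
  proof
    assume ?L
    then obtain b e' where e': "b \<in> dom M" "\<forall>v. v \<notin> set vs \<longrightarrow> e' v = (e(w := b)) v"
      "e' ` set vs \<subseteq> dom M" "sat M e' \<phi>"
      by blast
    then have "e' w \<in> dom M"
      by (cases "w \<in> set vs") auto
    then show ?R
      using e' by (intro exI[of _ e']) auto
  next
    assume ?R
    then obtain e' where "\<forall>v. v \<notin> set (w # vs) \<longrightarrow> e' v = e v"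
      "e' ` set (w # vs) \<subseteq> dom M" "sat M e' \<phi>"
      by blast
    then show ?L
      by (intro bexI[of _ "e' w"] exI[of _ e']) auto
  qed
  finally show ?case .
qed

lemma map_assign: "distinct vs \<Longrightarrow> length bs = length vs \<Longrightarrow> map (assign e vs bs) vs = bs"
  by (rule nth_equalityI) (auto simp: assign_def map_of_zip_nth)

lemma assign_notin: "v \<notin> set vs \<Longrightarrow> assign e vs bs v = e v"
proof -
  assume "v \<notin> set vs"
  then have "map_of (zip vs bs) v = None"
    by (auto simp: map_of_eq_None_iff dest: set_zip_leftD)
  then show ?thesis
    by (simp add: assign_def)
qed

lemma assign_map: "v \<in> set vs \<Longrightarrow> assign e vs (map f vs) v = f v"
  by (simp add: assign_def map_of_zip_map)

lemma assign_in_dom: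
  assumes "distinct vs" "bs \<in> tuples M vs" "v \<in> set vs"
  shows "assign e vs bs v \<in> dom M"
proof -
  have "assign e vs bs v \<in> set (map (assign e vs bs) vs)"
    using assms(3) by simp
  also have "map (assign e vs bs) vs = bs"
    using assms by (intro map_assign) (auto simp: tuples_def)
  finally show ?thesis
    using assms(2) by (auto simp: tuples_def)
qed

lemma tuples_eq_length: "length xs = length ys \<Longrightarrow> tuples M xs = tuples M ys"
  by (simp add: tuples_def)

text \<open>Saturation only covers types in a finite tuple of variables, so the variables are realized one
at a time.\<close>

lemma saturated_realizes_countable:
  fixes M :: "('f, 'r, 'm) struct" and \<kappa> :: "'k rel"
  assumes sat: "saturated \<kappa> L M"
    and small: "\<And>A :: 'm set. finite A \<Longrightarrow> |A| <o \<kappa>"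
    and wf: "\<And>\<phi>. \<phi> \<in> \<Gamma> \<Longrightarrow> wf_fm L \<phi>"
    and fin: "\<And>\<Delta>. finite \<Delta> \<Longrightarrow> \<Delta> \<subseteq> \<Gamma> \<Longrightarrow> \<exists>e. range e \<subseteq> dom M \<and> (\<forall>\<phi>\<in>\<Delta>. sat M e \<phi>)"
  shows "\<exists>e. range e \<subseteq> dom M \<and> (\<forall>\<phi>\<in>\<Gamma>. sat M e \<phi>)"
proof -
  \<comment> \<open>Invariant of the recursion on variables: fixing the values of \<open>f\<close>
    below \<open>n\<close> keeps \<Gamma> finitely satisfiable.\<close>
  define I where "I n f \<longleftrightarrow> (\<forall>\<Delta>. finite \<Delta> \<longrightarrow> \<Delta> \<subseteq> \<Gamma> \<longrightarrow>
    (\<exists>e. range e \<subseteq> dom M \<and> (\<forall>v<n. e v = f v) \<and> (\<forall>\<phi>\<in>\<Delta>. sat M e \<phi>)))" for n :: nat and f :: "nat \<Rightarrow> 'm"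
  obtain e0 :: "nat \<Rightarrow> 'm" where e0: "range e0 \<subseteq> dom M"
    using fin[of "{}"] by auto
  then have ne: "dom M \<noteq> {}" and e0': "\<And>v. e0 v \<in> dom M"
    by auto
  have I_dom: "f v \<in> dom M" if I: "I n f" and v: "v < n" for n f v
  proof -
    obtain e where "range e \<subseteq> dom M" "\<forall>v<n. e v = f v"
      using I[unfolded I_def, rule_format, of "{}"] by auto
    then show ?thesis
      using v by (metis rangeI subsetD)
  qed
  have step: "\<exists>g. I (Suc n) g \<and> (\<forall>v<n. g v = f v)" if I: "I n f" for n f
  proof -
    have "\<exists>vs. set vs = {v \<in> fv (Ands \<phi>s). n < v}" for \<phi>s :: "('f, 'r) fm list"
      using finite_list finite_fv by (metis finite_Collect_conjI Collect_mem_eq)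
    then obtain later where later: "\<And>\<phi>s :: ('f, 'r) fm list. set (later \<phi>s) = {v \<in> fv (Ands \<phi>s). n < v}"
      by metis
    \<comment> \<open>The type to be realized by the value of variable \<open>n\<close>: a finite
      part of \<Gamma> is conjoined and its variables above \<open>n\<close> are quantified away,
      while those below \<open>n\<close> are parameters with values given by
      \<open>f\<close>.\<close>
    define \<theta> where "\<theta> \<phi>s = (Exs (later \<phi>s) (Ands \<phi>s), f)" for \<phi>s
    define p where "p = \<theta> ` {\<phi>s. set \<phi>s \<subseteq> \<Gamma>}"
    have "p \<subseteq> over L [n] (f ` {..<n})"
    proof
      fix x assume "x \<in> p"
      then obtain \<phi>s where \<phi>s: "x = \<theta> \<phi>s" "set \<phi>s \<subseteq> \<Gamma>"
        by (auto simp: p_def)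
      have "fv (Exs (later \<phi>s) (Ands \<phi>s)) - {n} \<subseteq> {..<n}"
        by (auto simp: fv_Exs later)
      moreover have "wf_fm L (Exs (later \<phi>s) (Ands \<phi>s))"
        using \<phi>s(2) wf by (auto simp: wf_Exs wf_Ands)
      ultimately show "x \<in> over L [n] (f ` {..<n})"
        using \<phi>s(1) by (auto simp: over_def \<theta>_def)
    qed
    moreover have "f ` {..<n} \<subseteq> dom M"
      using I_dom[OF I] by auto
    moreover have "finitely_satisfiable M [n] p"
      unfolding finitely_satisfiable_def
    proof (intro allI impI)
      fix q assume "q \<subseteq> p" "finite q"
      then obtain X where X: "X \<subseteq> {\<phi>s. set \<phi>s \<subseteq> \<Gamma>}" "finite X" "q = \<theta> ` X"
        unfolding p_def by (meson finite_subset_image)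
      have "finite (\<Union> (set ` X))" "\<Union> (set ` X) \<subseteq> \<Gamma>"
        using X by auto
      then obtain e where e: "range e \<subseteq> dom M" "\<forall>v<n. e v = f v" "\<forall>\<phi>\<in>\<Union> (set ` X). sat M e \<phi>"
        using I[unfolded I_def, rule_format, of "\<Union> (set ` X)"] by blast
      have "sat M (assign f [n] [e n]) (Exs (later \<phi>s) (Ands \<phi>s))" if "\<phi>s \<in> X" for \<phi>s
      proof -
        let ?e = "\<lambda>v. if v \<in> set (later \<phi>s) then e v else assign f [n] [e n] v"
        have "sat M e (Ands \<phi>s)"
          using e(3) that ne by (auto simp: sat_Ands)
        also have "sat M e (Ands \<phi>s) \<longleftrightarrow> sat M ?e (Ands \<phi>s)"
          by (rule sat_cong) (use e(2) in \<open>auto simp: later assign_def\<close>)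
        finally show ?thesis
          unfolding sat_Exs using e(1) by (intro exI[of _ ?e]) auto
      qed
      then show "\<exists>bs\<in>tuples M [n]. \<forall>(\<phi>, e)\<in>q. sat M (assign e [n] bs) \<phi>"
        using e(1) X(3) by (intro bexI[of _ "[e n]"]) (auto simp: \<theta>_def tuples_def)
    qed
    ultimately obtain bs where bs: "bs \<in> tuples M [n]" "\<forall>(\<phi>, e)\<in>p. sat M (assign e [n] bs) \<phi>"
      using sat[unfolded saturated_def, rule_format, of "f ` {..<n}" "[n]" p] small by auto
    then obtain b where b: "bs = [b]" "b \<in> dom M"
      by (auto simp: tuples_def length_Suc_conv)
    have "I (Suc n) (f(n := b))"
      unfolding I_def
    proof (intro allI impI)
      fix \<Delta> assume \<Delta>: "finite \<Delta>" "\<Delta> \<subseteq> \<Gamma>"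
      then obtain \<phi>s where \<phi>s: "set \<phi>s = \<Delta>"
        using finite_list by blast
      then have "\<theta> \<phi>s \<in> p"
        using \<Delta>(2) by (auto simp: p_def)
      then have "sat M (assign f [n] [b]) (Exs (later \<phi>s) (Ands \<phi>s))"
        using bs(2) b(1) by (auto simp: \<theta>_def)
      then obtain e where e: "\<And>v. v \<notin> set (later \<phi>s) \<Longrightarrow> e v = assign f [n] [b] v"
        "e ` set (later \<phi>s) \<subseteq> dom M" "sat M e (Ands \<phi>s)"
        unfolding sat_Exs by blast
      \<comment> \<open>Variables up to \<open>n\<close> have their chosen values, later ones take
        the witnesses of the quantifiers, and the rest default to \<open>e0\<close> so that the
        range stays in the domain.\<close>
      let ?e = "\<lambda>v. if v \<le> n then (f(n := b)) v else if v \<in> set (later \<phi>s) then e v else e0 v"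
      have "sat M e (Ands \<phi>s) \<longleftrightarrow> sat M ?e (Ands \<phi>s)"
        by (rule sat_cong) (use e(1) in \<open>auto simp: later assign_def\<close>)
      then have "\<forall>\<phi>\<in>\<Delta>. sat M ?e \<phi>"
        using e(3) ne \<phi>s by (simp add: sat_Ands)
      moreover have "range ?e \<subseteq> dom M"
        using e(2) e0' b(2) I_dom[OF I] by auto
      ultimately show "\<exists>e. range e \<subseteq> dom M \<and> (\<forall>v<Suc n. e v = (f(n := b)) v) \<and> (\<forall>\<phi>\<in>\<Delta>. sat M e \<phi>)"
        by (intro exI[of _ ?e]) (simp add: less_Suc_eq_le)
    qed
    then show ?thesis
      by (intro exI[of _ "f(n := b)"]) auto
  qed
  have "I 0 e0"
    using fin by (simp add: I_def)
  then obtain F where F: "\<And>n. I n (F n)" "\<And>n v. v < n \<Longrightarrow> F (Suc n) v = F n v"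
    using dependent_nat_choice[of I "\<lambda>n f g. \<forall>v<n. g v = f v"] step by metis
  \<comment> \<open>The value of variable \<open>v\<close> is settled from stage
    \<open>Suc v\<close> on.\<close>
  define e where "e v = F (Suc v) v" for v
  have F_eq: "F n v = e v" if "v < n" for n v
    using that
  proof (induction n)
    case (Suc n)
    then show ?case
      using F(2)[of v n] by (cases "v = n") (auto simp: e_def)
  qed simp
  \<comment> \<open>A formula has finitely many free variables, so its truth is decided at a finite
    stage, where the invariant applies to \<open>{\<phi>}\<close>.\<close>
  have "sat M e \<phi>" if \<phi>: "\<phi> \<in> \<Gamma>" for \<phi>
  proof -
    obtain n where n: "\<And>v. v \<in> fv \<phi> \<Longrightarrow> v < n"
      using finite_fv[of \<phi>] by (meson finite_nat_set_iff_bounded)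
    obtain e' where "\<forall>v<n. e' v = F n v" "sat M e' \<phi>"
      using F(1)[of n, unfolded I_def, rule_format, of "{\<phi>}"] \<phi> by auto
    then show ?thesis
      using sat_cong[of \<phi> e' e M] n F_eq by simp
  qed
  moreover have "range e \<subseteq> dom M"
    using I_dom[OF F(1)] by (auto simp: e_def)
  ultimately show ?thesis
    by blast
qed

section \<open>Compactness for the antichain tree property\<close>

definition realizes ::
  "('f, 'r, 'm) struct \<Rightarrow> ('f, 'r) fm \<Rightarrow> nat list \<Rightarrow> nat list \<Rightarrow> 'm list \<Rightarrow> 'm list \<Rightarrow> bool" where
  "realizes M \<phi> xs ys b a \<longleftrightarrow> sat M (assign (assign (\<lambda>_. undefined) ys a) xs b) \<phi>"

lemma consistent_inst:
  "consistent M xs {inst \<phi> ys (a \<eta>) | \<eta>. \<eta> \<in> S} \<longleftrightarrow>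
     (\<exists>b\<in>tuples M xs. \<forall>\<eta>\<in>S. realizes M \<phi> xs ys b (a \<eta>))"
  by (fastforce simp: consistent_def inst_def realizes_def)

lemma realizes_map:
  assumes "partitioned_fm L \<phi> xs ys"
  shows "realizes M \<phi> xs ys (map e xs) (map e ys) \<longleftrightarrow> sat M e \<phi>"
  unfolding realizes_def
proof (rule sat_cong)
  fix v assume "v \<in> fv \<phi>"
  then have v: "v \<in> set xs \<or> v \<in> set ys"
    using assms by (auto simp: partitioned_fm_def)
  show "assign (assign (\<lambda>_. undefined) ys (map e ys)) xs (map e xs) v = e v"
  proof (cases "v \<in> set xs")
    case False
    then show ?thesis
      using v by (simp add: assign_notin assign_map)
  qed (simp add: assign_map)
qed

definition chain :: "bool list set \<Rightarrow> bool" where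
  "chain S \<longleftrightarrow> (\<forall>\<eta>\<in>S. \<forall>\<nu>\<in>S. comparable \<eta> \<nu>)"

text \<open>Chains of cardinality \<open>k\<close> replace the injective enumerations; with
  \<open>0 < k\<close> such a set is finite and can be enumerated.\<close>

lemma formula_has_k_ATP_iff:
  assumes "0 < k"
  shows "formula_has_k_ATP M \<phi> xs ys k \<longleftrightarrow>
    (\<exists>a. (\<forall>\<eta>. a \<eta> \<in> tuples M ys) \<and>
      (\<forall>A. antichain A \<longrightarrow> (\<exists>b\<in>tuples M xs. \<forall>\<eta>\<in>A. realizes M \<phi> xs ys b (a \<eta>))) \<and>
      (\<forall>S. chain S \<and> card S = k \<longrightarrow> \<not> (\<exists>b\<in>tuples M xs. \<forall>\<eta>\<in>S. realizes M \<phi> xs ys b (a \<eta>))))"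
proof -
  have "(\<forall>\<eta>. inj_on \<eta> {..<k} \<and> (\<forall>i<k. \<forall>j<k. comparable (\<eta> i) (\<eta> j)) \<longrightarrow>
      \<not> consistent M xs {inst \<phi> ys (a (\<eta> i)) | i. i < k}) \<longleftrightarrow>
    (\<forall>S. chain S \<and> card S = k \<longrightarrow> \<not> (\<exists>b\<in>tuples M xs. \<forall>\<eta>\<in>S. realizes M \<phi> xs ys b (a \<eta>)))"
    (is "?L \<longleftrightarrow> ?R") for a
  proof
    assume L: ?L
    show ?R
    proof (intro allI impI)
      fix S assume S: "chain S \<and> card S = k"
      then obtain \<eta> where \<eta>: "bij_betw \<eta> {..<k} S"
        using ex_bij_betw_nat_finite[of S] assms by (metis card_ge_0_finite lessThan_atLeast0)
      then have "inj_on \<eta> {..<k} \<and> (\<forall>i<k. \<forall>j<k. comparable (\<eta> i) (\<eta> j))"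
        using S by (auto simp: bij_betw_def chain_def)
      then have "\<not> consistent M xs {inst \<phi> ys (a (\<eta> i)) | i. i < k}"
        using L by blast
      also have "{inst \<phi> ys (a (\<eta> i)) | i. i < k} = {inst \<phi> ys (a \<nu>) | \<nu>. \<nu> \<in> S}"
        using \<eta> by (auto simp: bij_betw_def)
      finally show "\<not> (\<exists>b\<in>tuples M xs. \<forall>\<eta>\<in>S. realizes M \<phi> xs ys b (a \<eta>))"
        by (simp add: consistent_inst)
    qed
  next
    assume R: ?R
    show ?L
    proof (intro allI impI)
      fix \<eta> :: "nat \<Rightarrow> bool list"
      assume \<eta>: "inj_on \<eta> {..<k} \<and> (\<forall>i<k. \<forall>j<k. comparable (\<eta> i) (\<eta> j))"
      then have "chain (\<eta> ` {..<k}) \<and> card (\<eta> ` {..<k}) = k"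
        by (auto simp: chain_def card_image)
      then have "\<not> consistent M xs {inst \<phi> ys (a \<nu>) | \<nu>. \<nu> \<in> \<eta> ` {..<k}}"
        unfolding consistent_inst using R by blast
      also have "{inst \<phi> ys (a \<nu>) | \<nu>. \<nu> \<in> \<eta> ` {..<k}} = {inst \<phi> ys (a (\<eta> i)) | i. i < k}"
        by auto
      finally show "\<not> consistent M xs {inst \<phi> ys (a (\<eta> i)) | i. i < k}" .
    qed
  qed
  then show ?thesis
    unfolding formula_has_k_ATP_def consistent_inst[symmetric] by simp
qed

text \<open>The parameters may change with the depth \<open>n\<close>, and only nodes of length
  below \<open>n\<close> are constrained; \<open>compactness_k_ATP\<close> glues the depths
  together.\<close>

definition finite_k_ATP ::
  "('f, 'r, 'm) struct \<Rightarrow> ('f, 'r) fm \<Rightarrow> nat list \<Rightarrow> nat list \<Rightarrow> nat \<Rightarrow> bool" where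
  "finite_k_ATP M \<phi> xs ys k \<longleftrightarrow>
    (\<forall>n. \<exists>a. (\<forall>\<eta>. a \<eta> \<in> tuples M ys) \<and>
      (\<forall>A. antichain A \<and> (\<forall>\<eta>\<in>A. length \<eta> < n) \<longrightarrow>
        (\<exists>b\<in>tuples M xs. \<forall>\<eta>\<in>A. realizes M \<phi> xs ys b (a \<eta>))) \<and>
      (\<forall>S. chain S \<and> card S = k \<and> (\<forall>\<eta>\<in>S. length \<eta> < n) \<longrightarrow>
        \<not> (\<exists>b\<in>tuples M xs. \<forall>\<eta>\<in>S. realizes M \<phi> xs ys b (a \<eta>))))"

text \<open>Variables are tagged: copy \<open>c\<close> of \<open>\<phi>(x;y)\<close> keeps \<open>x\<close> (tag \<open>0\<close>) and gets its own \<open>y\<close>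
(tag \<open>Suc c\<close>).\<close>

definition copy_var :: "nat list \<Rightarrow> nat \<Rightarrow> nat \<Rightarrow> nat" where
  "copy_var ys c v = prod_encode (if v \<in> set ys then Suc c else 0, v)"

lemma inj_copy_var: "inj (copy_var ys c)"
  by (auto simp: inj_def copy_var_def)

definition tagged :: "nat \<Rightarrow> nat \<Rightarrow> nat" where
  "tagged t v = prod_encode (t, v)"

lemma inj_tagged: "inj (tagged t)"
  by (auto simp: inj_def tagged_def)

lemma tagged_eq [simp]: "tagged t v = tagged u w \<longleftrightarrow> t = u \<and> v = w"
  by (auto simp: tagged_def)

lemma map_copy_var:
  assumes "partitioned_fm L \<phi> xs ys"
  shows "map (copy_var ys c) xs = map (tagged 0) xs"
    and "map (copy_var ys c) ys = map (tagged (Suc c)) ys"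
  using assms by (auto simp: copy_var_def tagged_def partitioned_fm_def)

lemma sat_copy:
  assumes "partitioned_fm L \<phi> xs ys"
  shows "sat M e (ren (copy_var ys c) \<phi>) \<longleftrightarrow>
    realizes M \<phi> xs ys (map e (map (tagged 0) xs)) (map e (map (tagged (Suc c)) ys))"
proof -
  have "sat M e (ren (copy_var ys c) \<phi>) \<longleftrightarrow> sat M (e \<circ> copy_var ys c) \<phi>"
    by (rule sat_ren[OF inj_copy_var])
  also have "\<dots> \<longleftrightarrow> realizes M \<phi> xs ys (map (e \<circ> copy_var ys c) xs) (map (e \<circ> copy_var ys c) ys)"
    by (rule realizes_map[OF assms, symmetric])
  finally show ?thesis
    by (simp only: map_map[symmetric] map_copy_var[OF assms])
qed

lemma fv_copy:
  assumes "partitioned_fm L \<phi> xs ys"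
  shows "fv (ren (copy_var ys c) \<phi>) \<subseteq> tagged 0 ` set xs \<union> tagged (Suc c) ` set ys"
proof -
  have "fv (ren (copy_var ys c) \<phi>) = copy_var ys c ` fv \<phi>"
    by (rule fv_ren[OF inj_copy_var])
  also have "\<dots> \<subseteq> copy_var ys c ` (set xs \<union> set ys)"
    using assms by (auto simp: partitioned_fm_def)
  also have "\<dots> = set (map (copy_var ys c) xs) \<union> set (map (copy_var ys c) ys)"
    by auto
  finally show ?thesis
    by (simp only: map_copy_var[OF assms] set_map)
qed

text \<open>This undoes the tagging of variables; \<open>d\<close> fills the codes that belong to no
  variable of the tuples, so that all values can lie in the domain.\<close>

definition tag_eval ::
  "'m \<Rightarrow> nat list \<Rightarrow> nat list \<Rightarrow> 'm list \<Rightarrow> (nat \<Rightarrow> 'm list) \<Rightarrow> nat \<Rightarrow> 'm" where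
  "tag_eval d xs ys b a w = (case prod_decode w of
     (0, v) \<Rightarrow> assign (\<lambda>_. d) xs b v | (Suc c, v) \<Rightarrow> assign (\<lambda>_. d) ys (a c) v)"

lemma map_tag_eval:
  "distinct xs \<Longrightarrow> length b = length xs \<Longrightarrow> map (tag_eval d xs ys b a) (map (tagged 0) xs) = b"
  "distinct ys \<Longrightarrow> length (a c) = length ys \<Longrightarrow>
    map (tag_eval d xs ys b a) (map (tagged (Suc c)) ys) = a c"
  by (simp_all add: tag_eval_def tagged_def comp_def map_assign)

lemma assign_dom:
  assumes "d \<in> dom M" "distinct vs" "bs \<in> tuples M vs"
  shows "assign (\<lambda>_. d) vs bs v \<in> dom M"
  using assms by (cases "v \<in> set vs") (auto simp: assign_in_dom assign_notin)

lemma tag_eval_dom: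
  assumes "d \<in> dom M" "distinct xs" "distinct ys" "b \<in> tuples M xs" "\<And>c. a c \<in> tuples M ys"
  shows "tag_eval d xs ys b a w \<in> dom M"
  using assms by (auto simp: tag_eval_def intro: assign_dom split: prod.split nat.split)

text \<open>The formula is the conjunction of \<phi>(x;y_i) for i below \<open>m\<close>, with a
  common x. Its parameters are the concatenated parameters of the copies.\<close>

lemma conjunction_of_copies:
  fixes M :: "('f, 'r, 'm) struct"
  assumes \<phi>: "partitioned_fm L \<phi> xs ys" and ne: "dom M \<noteq> {}"
  obtains \<psi> xs' ys' where "partitioned_fm L \<psi> xs' ys'" "length xs' = length xs"
    "\<And>a. (\<And>i. a i \<in> tuples M ys) \<Longrightarrow> concat (map a [0..<m]) \<in> tuples M ys'"
    "\<And>a b. (\<And>i. a i \<in> tuples M ys) \<Longrightarrow> b \<in> tuples M xs \<Longrightarrow>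
      realizes M \<psi> xs' ys' b (concat (map a [0..<m])) \<longleftrightarrow> (\<forall>i<m. realizes M \<phi> xs ys b (a i))"
proof -
  let ?\<psi> = "Ands (map (\<lambda>c. ren (copy_var ys c) \<phi>) [0..<m])"
  let ?xs = "map (tagged 0) xs"
  let ?ys = "concat (map (\<lambda>c. map (tagged (Suc c)) ys) [0..<m])"
  have dist: "distinct xs" "distinct ys"
    using \<phi> by (auto simp: partitioned_fm_def)
  have "distinct ?xs"
    using dist(1) inj_on_subset[OF inj_tagged] by (auto simp: distinct_map)
  moreover have "distinct ?ys"
  proof (induction m)
    case (Suc m)
    then show ?case
      using dist(2) inj_on_subset[OF inj_tagged] by (auto simp: distinct_map)
  qed simp
  moreover have "fv ?\<psi> \<subseteq> set (?xs @ ?ys)"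
    using fv_copy[OF \<phi>] by (fastforce simp: fv_Ands)
  ultimately have \<psi>: "partitioned_fm L ?\<psi> ?xs ?ys"
    using \<phi> by (auto simp: partitioned_fm_def wf_Ands wf_ren)
  have len: "length (concat (map a [0..<m])) = length ?ys" if "\<And>i. a i \<in> tuples M ys" for a :: "nat \<Rightarrow> 'm list"
    using that by (induction m) (auto simp: tuples_def)
  show thesis
  proof (rule that[OF \<psi>])
    fix a :: "nat \<Rightarrow> 'm list" assume a: "\<And>i. a i \<in> tuples M ys"
    have "set (concat (map a [0..<m])) \<subseteq> dom M"
      using a by (fastforce simp: tuples_def)
    then show "concat (map a [0..<m]) \<in> tuples M ?ys"
      using len[OF a] by (simp add: tuples_def)
    fix b assume b: "b \<in> tuples M xs"
    obtain d where "d \<in> dom M"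
      using ne by blast
    let ?e = "tag_eval d xs ys b a"
    have e: "map ?e ?xs = b" "map ?e (map (tagged (Suc c)) ys) = a c" for c
      using dist a b by (simp_all only: map_tag_eval tuples_def mem_Collect_eq)
    have "map ?e ?ys = concat (map (\<lambda>c. map ?e (map (tagged (Suc c)) ys)) [0..<m])"
      by (simp add: map_concat comp_def)
    also have "\<dots> = concat (map a [0..<m])"
      by (simp only: e(2))
    finally have "map ?e ?ys = concat (map a [0..<m])" .
    then have "realizes M ?\<psi> ?xs ?ys b (concat (map a [0..<m])) \<longleftrightarrow> sat M ?e ?\<psi>"
      using realizes_map[OF \<psi>, of M ?e] e(1) by simp
    also have "\<dots> \<longleftrightarrow> (\<forall>i<m. realizes M \<phi> xs ys b (a i))"
      using sat_copy[OF \<phi>, of M ?e] e by (auto simp: sat_Ands[OF ne] simp del: map_map)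
    finally show "realizes M ?\<psi> ?xs ?ys b (concat (map a [0..<m])) \<longleftrightarrow>
      (\<forall>i<m. realizes M \<phi> xs ys b (a i))" .
  qed simp
qed

text \<open>The formulas \<open>Eq (Var v) (Var v)\<close> are already infinite in number, so a
  countable set embeds into the set of formulas.\<close>

lemma monster_small:
  fixes M :: "('f, 'r, 'm) struct" and \<kappa> :: "'k rel" and A :: "'b set"
  assumes "monster_model \<kappa> L T M" "countable A"
  shows "|A| <o \<kappa>"
proof -
  let ?F = "{\<phi> :: ('f, 'r) fm. wf_fm L \<phi>}"
  let ?f = "\<lambda>v. Eq (Var v) (Var v) :: ('f, 'r) fm"
  obtain g :: "'b \<Rightarrow> nat" where g: "inj_on g A"
    using assms(2) by (auto simp: countable_def)
  have "inj_on (?f \<circ> g) A" "(?f \<circ> g) ` A \<subseteq> ?F"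
    using g by (auto simp: inj_on_def)
  then have "|A| \<le>o |?F|"
    by (auto simp: card_of_ordLeq[symmetric])
  moreover have "|?F| <o \<kappa>"
    using assms(1) by (simp add: monster_model_def)
  ultimately show ?thesis
    by (rule ordLeq_ordLess_trans)
qed

text \<open>Consistency of finitely many instances becomes a formula in the parameter variables, so
  that saturation can be used to find the parameters themselves.\<close>

lemma sat_Exs_copies:
  fixes M :: "('f, 'r, 'm) struct"
  assumes \<phi>: "partitioned_fm L \<phi> xs ys" and ne: "dom M \<noteq> {}"
  shows "sat M e (Exs (map (tagged 0) xs) (Ands (map (\<lambda>c. ren (copy_var ys c) \<phi>) cs))) \<longleftrightarrow>
    (\<exists>b\<in>tuples M xs. \<forall>c\<in>set cs. realizes M \<phi> xs ys b (map e (map (tagged (Suc c)) ys)))"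
    (is "?L \<longleftrightarrow> ?R")
proof
  let ?xs = "map (tagged 0) xs"
  have copy_ys: "map e' (map (tagged (Suc c)) ys) = map e (map (tagged (Suc c)) ys)"
    if "\<And>v. v \<notin> set ?xs \<Longrightarrow> e' v = e v" for e' c
  proof -
    have "tagged (Suc c) v \<notin> set ?xs" for v
      by auto
    then show ?thesis
      using that by simp
  qed
  have "distinct xs"
    using \<phi> by (simp add: partitioned_fm_def)
  then have dist: "distinct ?xs"
    using inj_on_subset[OF inj_tagged] by (auto simp: distinct_map)
  show ?R if L: ?L
  proof -
    obtain e' where off: "\<forall>v. v \<notin> set ?xs \<longrightarrow> e' v = e v" and "e' ` set ?xs \<subseteq> dom M"
      and "sat M e' (Ands (map (\<lambda>c. ren (copy_var ys c) \<phi>) cs))"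
      using L unfolding sat_Exs by (elim exE conjE)
    then have e': "e' ` set ?xs \<subseteq> dom M"
      "\<And>c. c \<in> set cs \<Longrightarrow> sat M e' (ren (copy_var ys c) \<phi>)"
      by (simp_all add: sat_Ands[OF ne])
    have "map e' ?xs \<in> tuples M xs"
      using e'(1) by (auto simp: tuples_def)
    moreover have "realizes M \<phi> xs ys (map e' ?xs) (map e (map (tagged (Suc c)) ys))"
      if "c \<in> set cs" for c
    proof -
      have "map e' (map (tagged (Suc c)) ys) = map e (map (tagged (Suc c)) ys)"
        by (rule copy_ys) (use off in blast)
      then show ?thesis
        using e'(2)[OF that] by (simp only: sat_copy[OF \<phi>])
    qed
    ultimately show ?thesis
      by blast
  qed
  show ?L if R: ?R
  proof -
    obtain b where b: "b \<in> tuples M xs"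
      "\<And>c. c \<in> set cs \<Longrightarrow> realizes M \<phi> xs ys b (map e (map (tagged (Suc c)) ys))"
      using R by blast
    let ?e = "assign e ?xs b"
    have b': "b \<in> tuples M ?xs"
      using b(1) by (simp add: tuples_def)
    have off: "?e v = e v" if "v \<notin> set ?xs" for v
      using that by (rule assign_notin)
    have xs: "map ?e ?xs = b"
      using dist b(1) by (intro map_assign) (auto simp: tuples_def)
    have "map ?e (map (tagged (Suc c)) ys) = map e (map (tagged (Suc c)) ys)" for c
      by (rule copy_ys) (rule off)
    then have "sat M ?e (ren (copy_var ys c) \<phi>)" if "c \<in> set cs" for c
      using b(2)[OF that] by (simp only: sat_copy[OF \<phi>] xs)
    moreover have "?e ` set ?xs \<subseteq> dom M"
      using assign_in_dom[OF dist b'] by blast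
    ultimately show ?thesis
      unfolding sat_Exs using off by (intro exI[of _ ?e]) (simp add: sat_Ands[OF ne])
  qed
qed

text \<open>Saturation is used twice: to realize the countably many conditions that the finite
  depths impose on the parameters, and to pass from finite antichains to arbitrary ones.\<close>

lemma compactness_k_ATP:
  fixes M :: "('f, 'r, 'm) struct" and \<kappa> :: "'k rel"
  assumes M: "monster_model \<kappa> L T M" and \<phi>: "partitioned_fm L \<phi> xs ys"
    and "0 < k" and fin: "finite_k_ATP M \<phi> xs ys k"
  shows "formula_has_k_ATP M \<phi> xs ys k"
proof -
  have ne: "dom M \<noteq> {}" and sat: "saturated \<kappa> L M"
    using M by (auto simp: monster_model_def model_of_def is_struct_def)
  have dist: "distinct xs" "distinct ys"
    using \<phi> by (auto simp: partitioned_fm_def)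
  \<comment> \<open>The parameters of node \<eta> are represented by the y-variables of copy
    \<open>to_nat \<eta>\<close>; \<theta> says that the instances at the listed nodes have a common
    solution.\<close>
  define \<theta> where "\<theta> \<eta>s = Exs (map (tagged 0) xs)
    (Ands (map (\<lambda>c. ren (copy_var ys c) \<phi>) (map to_nat \<eta>s)))" for \<eta>s :: "bool list list"
  have \<theta>: "sat M e (\<theta> \<eta>s) \<longleftrightarrow> (\<exists>b\<in>tuples M xs. \<forall>\<eta>\<in>set \<eta>s.
      realizes M \<phi> xs ys b (map e (map (tagged (Suc (to_nat \<eta>))) ys)))" for e \<eta>s
    unfolding \<theta>_def sat_Exs_copies[OF \<phi> ne] by simp
  have wf_\<theta>: "wf_fm L (\<theta> \<eta>s)" for \<eta>s
    using \<phi> by (auto simp: \<theta>_def wf_Exs wf_Ands wf_ren partitioned_fm_def)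
  define \<Gamma> where "\<Gamma> n = {\<theta> \<eta>s | \<eta>s. antichain (set \<eta>s) \<and> (\<forall>\<eta>\<in>set \<eta>s. length \<eta> < n)} \<union>
    {Neg (\<theta> \<eta>s) | \<eta>s. chain (set \<eta>s) \<and> card (set \<eta>s) = k \<and> (\<forall>\<eta>\<in>set \<eta>s. length \<eta> < n)}" for n
  have \<Gamma>_mono: "\<Gamma> m \<subseteq> \<Gamma> n" if "m \<le> n" for m n
    unfolding \<Gamma>_def using that by (fastforce dest: order.strict_trans2)
  have \<Gamma>_fin: "\<exists>e. range e \<subseteq> dom M \<and> (\<forall>\<psi>\<in>\<Gamma> n. sat M e \<psi>)" for n
  proof -
    obtain a where a: "\<And>\<eta>. a \<eta> \<in> tuples M ys"
      "\<And>A. antichain A \<Longrightarrow> (\<forall>\<eta>\<in>A. length \<eta> < n) \<Longrightarrow>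
        (\<exists>b\<in>tuples M xs. \<forall>\<eta>\<in>A. realizes M \<phi> xs ys b (a \<eta>))"
      "\<And>S. chain S \<Longrightarrow> card S = k \<Longrightarrow> (\<forall>\<eta>\<in>S. length \<eta> < n) \<Longrightarrow>
        \<not> (\<exists>b\<in>tuples M xs. \<forall>\<eta>\<in>S. realizes M \<phi> xs ys b (a \<eta>))"
      using fin[unfolded finite_k_ATP_def, rule_format, of n] by (elim exE conjE) metis
    obtain d where d: "d \<in> dom M"
      using ne by blast
    \<comment> \<open>The x-variables are bound in \<theta>, so any values will do for them.\<close>
    let ?b = "map (\<lambda>_. d) xs"
    let ?e = "tag_eval d xs ys ?b (\<lambda>c. a (from_nat c))"
    have e: "map ?e (map (tagged (Suc (to_nat \<eta>))) ys) = a \<eta>" for \<eta> :: "bool list"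
      using map_tag_eval(2)[OF dist(2), of "\<lambda>c. a (from_nat c)" "to_nat \<eta>"] a(1)
      by (simp add: tuples_def del: map_map)
    have "?b \<in> tuples M xs"
      using d by (auto simp: tuples_def)
    then have "range ?e \<subseteq> dom M"
      using tag_eval_dom[OF d dist _ a(1)] by blast
    moreover have "\<forall>\<psi>\<in>\<Gamma> n. sat M ?e \<psi>"
      unfolding \<Gamma>_def using a(2,3) by (auto simp: \<theta> e simp del: map_map)
    ultimately show ?thesis
      by blast
  qed
  have "\<exists>e. range e \<subseteq> dom M \<and> (\<forall>\<psi>\<in>(\<Union>n. \<Gamma> n). sat M e \<psi>)"
  proof (rule saturated_realizes_countable[OF sat])
    show "|A| <o \<kappa>" if "finite A" for A :: "'m set"
      using monster_small[OF M] that countable_finite by blast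
    show "wf_fm L \<psi>" if "\<psi> \<in> (\<Union>n. \<Gamma> n)" for \<psi>
      using that wf_\<theta> by (auto simp: \<Gamma>_def)
    fix \<Delta> assume "finite \<Delta>" "\<Delta> \<subseteq> (\<Union>n. \<Gamma> n)"
    \<comment> \<open>The sets \<open>\<Gamma> n\<close> increase with \<open>n\<close>, so a finite
      part of their union lies in one of them.\<close>
    then have "\<exists>n. \<Delta> \<subseteq> \<Gamma> n"
    proof (induction \<Delta> rule: finite_induct)
      case (insert \<psi> \<Delta>)
      then obtain m n where "\<Delta> \<subseteq> \<Gamma> m" "\<psi> \<in> \<Gamma> n"
        by auto
      then have "insert \<psi> \<Delta> \<subseteq> \<Gamma> (max m n)"
        using \<Gamma>_mono[of m "max m n"] \<Gamma>_mono[of n "max m n"] by auto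
      then show ?case
        by blast
    qed simp
    then obtain n where n: "\<Delta> \<subseteq> \<Gamma> n"
      by blast
    obtain e where "range e \<subseteq> dom M" "\<forall>\<psi>\<in>\<Gamma> n. sat M e \<psi>"
      using \<Gamma>_fin[of n] by (elim exE conjE)
    then show "\<exists>e. range e \<subseteq> dom M \<and> (\<forall>\<psi>\<in>\<Delta>. sat M e \<psi>)"
      using n by (intro exI[of _ e]) auto
  qed
  then obtain e where e: "range e \<subseteq> dom M" and "\<forall>\<psi>\<in>(\<Union>n. \<Gamma> n). sat M e \<psi>"
    by (elim exE conjE)
  then have e_sat: "sat M e \<psi>" if "\<psi> \<in> \<Gamma> n" for n \<psi>
    using that by auto
  define a where "a \<eta> = map e (map (tagged (Suc (to_nat \<eta>))) ys)" for \<eta> :: "bool list"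
  have \<theta>': "sat M e (\<theta> \<eta>s) \<longleftrightarrow> (\<exists>b\<in>tuples M xs. \<forall>\<eta>\<in>set \<eta>s. realizes M \<phi> xs ys b (a \<eta>))" for \<eta>s
    by (simp only: \<theta> a_def)
  have bound: "\<exists>n. \<forall>\<eta>\<in>set \<eta>s. length \<eta> < n" for \<eta>s :: "bool list list"
    by (intro exI[of _ "Suc (Max (length ` set \<eta>s))"]) (auto simp: less_Suc_eq_le)
  have a: "a \<eta> \<in> tuples M ys" for \<eta>
    using e by (auto simp: a_def tuples_def)
  have anti: "\<exists>b\<in>tuples M xs. \<forall>\<eta>\<in>A. realizes M \<phi> xs ys b (a \<eta>)"
    if A: "antichain A" "finite A" for A
  proof -
    obtain \<eta>s where \<eta>s: "set \<eta>s = A"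
      using finite_list[OF A(2)] by blast
    obtain n where "\<forall>\<eta>\<in>set \<eta>s. length \<eta> < n"
      using bound by blast
    then have "\<theta> \<eta>s \<in> \<Gamma> n"
      using A(1) \<eta>s by (auto simp: \<Gamma>_def)
    then show ?thesis
      using e_sat \<theta>' \<eta>s by blast
  qed
  have ch: "\<not> (\<exists>b\<in>tuples M xs. \<forall>\<eta>\<in>S. realizes M \<phi> xs ys b (a \<eta>))"
    if S: "chain S" "card S = k" for S
  proof -
    have "finite S"
      using S(2) \<open>0 < k\<close> by (metis card_ge_0_finite)
    then obtain \<eta>s where \<eta>s: "set \<eta>s = S"
      using finite_list by blast
    obtain n where "\<forall>\<eta>\<in>set \<eta>s. length \<eta> < n"
      using bound by blast
    then have "Neg (\<theta> \<eta>s) \<in> \<Gamma> n"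
      using S \<eta>s by (auto simp: \<Gamma>_def)
    then have "\<not> sat M e (\<theta> \<eta>s)"
      using e_sat by fastforce
    then show ?thesis
      using \<theta>' \<eta>s by blast
  qed
  \<comment> \<open>Second use of saturation: the finite parts are consistent by
    \<open>anti\<close>, and all parameters lie in the countable set \<open>range e\<close>.\<close>
  have "\<exists>b\<in>tuples M xs. \<forall>\<eta>\<in>A. realizes M \<phi> xs ys b (a \<eta>)" if A: "antichain A" for A
  proof -
    let ?p = "\<lambda>A. {inst \<phi> ys (a \<eta>) | \<eta>. \<eta> \<in> A}"
    have "finitely_satisfiable M xs (?p A)"
      unfolding finitely_satisfiable_def
    proof (intro allI impI)
      fix q assume q: "q \<subseteq> ?p A" "finite q"
      have "?p A = (\<lambda>\<eta>. inst \<phi> ys (a \<eta>)) ` A"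
        by auto
      then obtain B where B: "B \<subseteq> A" "finite B" "q = (\<lambda>\<eta>. inst \<phi> ys (a \<eta>)) ` B"
        using q finite_subset_image[of q "\<lambda>\<eta>. inst \<phi> ys (a \<eta>)" A] by auto
      have "q = ?p B"
        using B(3) by auto
      moreover have "consistent M xs (?p B)"
        unfolding consistent_inst using anti[OF _ B(2)] antichain_subset[OF A B(1)] by blast
      ultimately show "\<exists>bs\<in>tuples M xs. \<forall>(\<phi>, e)\<in>q. sat M (assign e xs bs) \<phi>"
        by (simp add: consistent_def)
    qed
    moreover have "?p A \<subseteq> over L xs (range e)"
    proof
      fix \<psi> assume "\<psi> \<in> ?p A"
      then obtain \<eta> where \<eta>: "\<psi> = (\<phi>, assign (\<lambda>_. undefined) ys (a \<eta>))"
        by (auto simp: inst_def)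
      have "assign (\<lambda>_. undefined) ys (a \<eta>) v \<in> range e" if "v \<in> fv \<phi> - set xs" for v
      proof -
        have "v \<in> set ys"
          using \<phi> that by (auto simp: partitioned_fm_def)
        then show ?thesis
          by (simp add: a_def assign_map)
      qed
      then show "\<psi> \<in> over L xs (range e)"
        using \<phi> \<eta> by (auto simp: over_def partitioned_fm_def)
    qed
    moreover have "|range e| <o \<kappa>"
      using monster_small[OF M, of "range e"] by simp
    ultimately have "consistent M xs (?p A)"
      using consistent_iff_finitely[OF M e _ dist(1)] by blast
    then show ?thesis
      by (simp add: consistent_inst)
  qed
  then show ?thesis
    unfolding formula_has_k_ATP_iff[OF \<open>0 < k\<close>] using a ch by blast
qed

section \<open>Lowering the chain length\<close>

text \<open>The lower nodes of the pairs form a chain of the same length. One upper node fits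
  strictly between its own lower node and all later pairs, which adds exactly the one element needed
  for inconsistency.\<close>

lemma doubling_chain:
  assumes s: "doubling n \<sigma> s" and S: "chain S" "\<And>\<eta>. \<eta> \<in> S \<Longrightarrow> length \<eta> < n" and "\<eta>0 \<in> S"
  shows "chain (insert (snd (s \<eta>0)) (fst ` s ` S))"
    and "finite S \<Longrightarrow> card (insert (snd (s \<eta>0)) (fst ` s ` S)) = Suc (card S)"
proof -
  have up: "strict_prefix (fst (s \<eta>)) (snd (s \<eta>))" if "\<eta> \<in> S" for \<eta>
    using s S(2)[OF that] by (simp add: doubling_def)
  have next_up: "strict_prefix (snd (s \<eta>)) (fst (s \<nu>))"
    if "\<eta> \<in> S" "\<nu> \<in> S" "strict_prefix \<eta> \<nu>" for \<eta> \<nu>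
    using s S(2)[OF that(1)] S(2)[OF that(2)] that(3) by (simp add: doubling_def)
  have cases: "\<eta> = \<nu> \<or> strict_prefix \<eta> \<nu> \<or> strict_prefix \<nu> \<eta>" if "\<eta> \<in> S" "\<nu> \<in> S" for \<eta> \<nu>
    using S(1) that by (auto simp: chain_def comparable_def strict_prefix_def)
  have fst_less: "strict_prefix (fst (s \<eta>)) (fst (s \<nu>))"
    if "\<eta> \<in> S" "\<nu> \<in> S" "strict_prefix \<eta> \<nu>" for \<eta> \<nu>
    using up[OF that(1)] next_up[OF that] by (rule prefix_order.less_trans)
  have snd_fst: "strict_prefix (snd (s \<eta>0)) (fst (s \<eta>)) \<or> strict_prefix (fst (s \<eta>)) (snd (s \<eta>0))"
    if "\<eta> \<in> S" for \<eta>
    using cases[OF assms(4) that]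
  proof (elim disjE)
    assume "strict_prefix \<eta> \<eta>0"
    then show ?thesis
      using fst_less[OF that assms(4)] up[OF assms(4)] prefix_order.less_trans by blast
  qed (use up next_up assms(4) that in blast)+
  have "comparable (fst (s \<eta>)) (fst (s \<nu>))" if "\<eta> \<in> S" "\<nu> \<in> S" for \<eta> \<nu>
    using cases[OF that] fst_less that by (auto simp: comparable_def strict_prefix_def)
  moreover have "comparable (snd (s \<eta>0)) (fst (s \<eta>))" if "\<eta> \<in> S" for \<eta>
    using snd_fst[OF that] by (auto simp: comparable_def strict_prefix_def)
  ultimately show "chain (insert (snd (s \<eta>0)) (fst ` s ` S))"
    using comparable_sym by (auto simp: chain_def) (simp add: comparable_def)
  assume "finite S"
  have "inj_on (\<lambda>\<eta>. fst (s \<eta>)) S"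
  proof (rule inj_onI)
    fix \<eta> \<nu> assume *: "\<eta> \<in> S" "\<nu> \<in> S" "fst (s \<eta>) = fst (s \<nu>)"
    then show "\<eta> = \<nu>"
      using cases[OF *(1,2)] fst_less[OF *(1,2)] fst_less[OF *(2,1)] by auto
  qed
  then have "card (fst ` s ` S) = card S"
    by (simp add: image_image card_image)
  moreover have "snd (s \<eta>0) \<notin> fst ` s ` S"
    using snd_fst by fastforce
  ultimately show "card (insert (snd (s \<eta>0)) (fst ` s ` S)) = Suc (card S)"
    using \<open>finite S\<close> by simp
qed

text \<open>Within one copy incomparability comes from the embedding, between different copies from
  the second clause of \<open>spread\<close>.\<close>

lemma spread_antichain:
  assumes H: "spread \<sigma> A H" and X: "antichain X"
  shows "antichain {H \<eta> \<zeta> | \<eta> \<zeta>. \<eta> \<in> A \<and> \<zeta> \<in> X}"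
proof -
  have "\<not> comparable (H \<eta> \<zeta>) (H \<nu> \<xi>)"
    if "\<eta> \<in> A" "\<nu> \<in> A" "\<zeta> \<in> X" "\<xi> \<in> X" "H \<eta> \<zeta> \<noteq> H \<nu> \<xi>" for \<eta> \<nu> \<zeta> \<xi>
  proof (cases "\<eta> = \<nu>")
    case True
    then have "\<zeta> \<noteq> \<xi>" "tree_emb (H \<nu>)"
      using that H by (auto simp: spread_def)
    then show ?thesis
      using True that X tree_emb_comparable by (auto simp: antichain_def)
  next
    case False
    then show ?thesis
      using that H by (simp add: spread_def)
  qed
  then show ?thesis
    unfolding antichain_def by blast
qed

lemma k_ATP_step:
  fixes M :: "('f, 'r, 'm) struct" and \<kappa> :: "'k rel"
  assumes M: "monster_model \<kappa> L T M" and "has_k_ATP L M (Suc k)" "2 \<le> k"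
  shows "has_k_ATP L M k \<or> has_ATP L M"
proof -
  have ne: "dom M \<noteq> {}"
    using M by (auto simp: monster_model_def model_of_def is_struct_def)
  obtain \<phi> xs ys where \<phi>: "partitioned_fm L \<phi> xs ys" "formula_has_k_ATP M \<phi> xs ys (Suc k)"
    using assms(2) by (auto simp: has_k_ATP_def)
  define R where "R = realizes M \<phi> xs ys"
  obtain a where a: "\<And>\<eta>. a \<eta> \<in> tuples M ys"
    "\<And>A. antichain A \<Longrightarrow> \<exists>b\<in>tuples M xs. \<forall>\<eta>\<in>A. R b (a \<eta>)"
    "\<And>S. chain S \<Longrightarrow> card S = Suc k \<Longrightarrow> \<not> (\<exists>b\<in>tuples M xs. \<forall>\<eta>\<in>S. R b (a \<eta>))"
    using \<phi>(2) unfolding formula_has_k_ATP_iff[OF zero_less_Suc] R_def by (elim exE conjE) metis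
  \<comment> \<open>The dichotomy is applied to consistency of sets of nodes: either every depth has
    a doubling with consistent doubled antichains, or some depth provides a set \<open>A\<close>
    with inconsistent grids.\<close>
  define C where "C X \<longleftrightarrow> (\<exists>b\<in>tuples M xs. \<forall>\<eta>\<in>X. R b (a \<eta>))" for X
  consider (double) "\<And>n. \<exists>s. doubling n [] s \<and>
      (\<forall>A. antichain A \<and> (\<forall>\<eta>\<in>A. length \<eta> < n) \<longrightarrow> C (doubled s A))"
    | (grid) A where "finite A" "\<And>N. \<exists>H. spread [] A H \<and>
      (\<forall>s. grid N A H s \<longrightarrow> \<not> C (doubled s A))"
    using doubling_or_grid[of _ C] by metis
  then show ?thesis
  proof cases
    case double
    \<comment> \<open>\<psi> is \<phi>(x;y) \<and> \<phi>(x;y'), and the two nodes of a pair supply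
      its parameters; it will have \<open>k\<close>-ATP.\<close>
    obtain \<psi> xs' ys' where \<psi>: "partitioned_fm L \<psi> xs' ys'" "length xs' = length xs"
      "\<And>c. (\<And>i. c i \<in> tuples M ys) \<Longrightarrow> concat (map c [0..<2]) \<in> tuples M ys'"
      "\<And>c b. (\<And>i. c i \<in> tuples M ys) \<Longrightarrow> b \<in> tuples M xs \<Longrightarrow>
        realizes M \<psi> xs' ys' b (concat (map c [0..<2])) \<longleftrightarrow> (\<forall>i<2. R b (c i))"
      unfolding R_def using conjunction_of_copies[OF \<phi>(1) ne, of 2] by blast
    note xs' = tuples_eq_length[OF \<psi>(2), of M]
    have "finite_k_ATP M \<psi> xs' ys' k"
      unfolding finite_k_ATP_def xs'
    proof
      fix n
      obtain s where s: "doubling n [] s"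
        "\<And>A. antichain A \<Longrightarrow> \<forall>\<eta>\<in>A. length \<eta> < n \<Longrightarrow> C (doubled s A)"
        using double by blast
      define c where "c \<eta> i = a (if i = (0::nat) then fst (s \<eta>) else snd (s \<eta>))" for \<eta> i
      define a' where "a' \<eta> = concat (map (c \<eta>) [0..<2])" for \<eta>
      have c: "c \<eta> i \<in> tuples M ys" for \<eta> i
        using a(1) by (simp add: c_def)
      have R': "realizes M \<psi> xs' ys' b (a' \<eta>) \<longleftrightarrow> R b (a (fst (s \<eta>))) \<and> R b (a (snd (s \<eta>)))"
        if "b \<in> tuples M xs" for b \<eta>
        using \<psi>(4)[of "c \<eta>", OF c that] by (auto simp: a'_def c_def numeral_2_eq_2 less_Suc_eq)
      show "\<exists>a. (\<forall>\<eta>. a \<eta> \<in> tuples M ys') \<and>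
          (\<forall>A. antichain A \<and> (\<forall>\<eta>\<in>A. length \<eta> < n) \<longrightarrow>
            (\<exists>b\<in>tuples M xs. \<forall>\<eta>\<in>A. realizes M \<psi> xs' ys' b (a \<eta>))) \<and>
          (\<forall>S. chain S \<and> card S = k \<and> (\<forall>\<eta>\<in>S. length \<eta> < n) \<longrightarrow>
            \<not> (\<exists>b\<in>tuples M xs. \<forall>\<eta>\<in>S. realizes M \<psi> xs' ys' b (a \<eta>)))"
      proof (intro exI[of _ a'] conjI allI impI)
        show "a' \<eta> \<in> tuples M ys'" for \<eta>
          using \<psi>(3)[of "c \<eta>", OF c] by (simp add: a'_def)
      next
        fix A assume "antichain A \<and> (\<forall>\<eta>\<in>A. length \<eta> < n)"
        then have "C (doubled s A)"
          using s(2) by blast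
        then show "\<exists>b\<in>tuples M xs. \<forall>\<eta>\<in>A. realizes M \<psi> xs' ys' b (a' \<eta>)"
          unfolding C_def doubled_def using R' by fastforce
      next
        fix S assume S: "chain S \<and> card S = k \<and> (\<forall>\<eta>\<in>S. length \<eta> < n)"
        then have fin: "finite S" and "S \<noteq> {}"
          using assms(3) by (auto intro: card_ge_0_finite)
        then obtain \<eta>0 where \<eta>0: "\<eta>0 \<in> S"
          by blast
        \<comment> \<open>A common solution for the doubled instances along \<open>S\<close> would
          realize \<phi> on this chain of \<open>Suc k\<close> nodes.\<close>
        let ?T = "insert (snd (s \<eta>0)) (fst ` s ` S)"
        have "\<not> (\<exists>b\<in>tuples M xs. \<forall>\<eta>\<in>?T. R b (a \<eta>))"
          using doubling_chain[OF s(1) _ _ \<eta>0] S fin by (intro a(3)) auto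
        then show "\<not> (\<exists>b\<in>tuples M xs. \<forall>\<eta>\<in>S. realizes M \<psi> xs' ys' b (a' \<eta>))"
          using R' \<eta>0 by auto
      qed
    qed
    then have "formula_has_k_ATP M \<psi> xs' ys' k"
      using compactness_k_ATP[OF M \<psi>(1)] assms(3) by simp
    then show ?thesis
      using \<psi>(1) by (auto simp: has_k_ATP_def)
  next
    case grid
    \<comment> \<open>One copy of \<phi> is conjoined for each element of \<open>A\<close>. Since
      \<open>A\<close> is the same for all depths, so is the resulting \<psi>, which will have
      ATP.\<close>
    define m where "m = card A"
    obtain g where g: "bij_betw g {..<m} A"
      using ex_bij_betw_nat_finite[OF grid(1)] by (auto simp: m_def lessThan_atLeast0)
    obtain \<psi> xs' ys' where \<psi>: "partitioned_fm L \<psi> xs' ys'" "length xs' = length xs"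
      "\<And>c. (\<And>i. c i \<in> tuples M ys) \<Longrightarrow> concat (map c [0..<m]) \<in> tuples M ys'"
      "\<And>c b. (\<And>i. c i \<in> tuples M ys) \<Longrightarrow> b \<in> tuples M xs \<Longrightarrow>
        realizes M \<psi> xs' ys' b (concat (map c [0..<m])) \<longleftrightarrow> (\<forall>i<m. R b (c i))"
      unfolding R_def using conjunction_of_copies[OF \<phi>(1) ne, of m] by blast
    note xs' = tuples_eq_length[OF \<psi>(2), of M]
    have "finite_k_ATP M \<psi> xs' ys' 2"
      unfolding finite_k_ATP_def xs'
    proof
      fix n
      obtain H where H: "spread [] A H" "\<And>s. grid n A H s \<Longrightarrow> \<not> C (doubled s A)"
        using grid(2) by blast
      define c where "c \<zeta> i = a (H (g i) \<zeta>)" for \<zeta> i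
      define a' where "a' \<zeta> = concat (map (c \<zeta>) [0..<m])" for \<zeta>
      have c: "c \<zeta> i \<in> tuples M ys" for \<zeta> i
        using a(1) by (simp add: c_def)
      have R': "realizes M \<psi> xs' ys' b (a' \<zeta>) \<longleftrightarrow> (\<forall>\<eta>\<in>A. R b (a (H \<eta> \<zeta>)))"
        if "b \<in> tuples M xs" for b \<zeta>
      proof -
        have "A = g ` {..<m}"
          using g by (simp add: bij_betw_def)
        then show ?thesis
          using \<psi>(4)[of "c \<zeta>", OF c that] by (auto simp: a'_def c_def)
      qed
      show "\<exists>a. (\<forall>\<eta>. a \<eta> \<in> tuples M ys') \<and>
          (\<forall>A. antichain A \<and> (\<forall>\<eta>\<in>A. length \<eta> < n) \<longrightarrow>
            (\<exists>b\<in>tuples M xs. \<forall>\<eta>\<in>A. realizes M \<psi> xs' ys' b (a \<eta>))) \<and>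
          (\<forall>S. chain S \<and> card S = 2 \<and> (\<forall>\<eta>\<in>S. length \<eta> < n) \<longrightarrow>
            \<not> (\<exists>b\<in>tuples M xs. \<forall>\<eta>\<in>S. realizes M \<psi> xs' ys' b (a \<eta>)))"
      proof (intro exI[of _ a'] conjI allI impI)
        show "a' \<zeta> \<in> tuples M ys'" for \<zeta>
          using \<psi>(3)[of "c \<zeta>", OF c] by (simp add: a'_def)
      next
        fix X assume "antichain X \<and> (\<forall>\<zeta>\<in>X. length \<zeta> < n)"
        then have "\<exists>b\<in>tuples M xs. \<forall>\<nu>\<in>{H \<eta> \<zeta> | \<eta> \<zeta>. \<eta> \<in> A \<and> \<zeta> \<in> X}. R b (a \<nu>)"
          using a(2) spread_antichain[OF H(1)] by blast
        then obtain b where "b \<in> tuples M xs" "\<And>\<eta> \<zeta>. \<eta> \<in> A \<Longrightarrow> \<zeta> \<in> X \<Longrightarrow> R b (a (H \<eta> \<zeta>))"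
          by blast
        then show "\<exists>b\<in>tuples M xs. \<forall>\<zeta>\<in>X. realizes M \<psi> xs' ys' b (a' \<zeta>)"
          using R' by blast
      next
        fix S assume S: "chain S \<and> card S = 2 \<and> (\<forall>\<eta>\<in>S. length \<eta> < n)"
        obtain \<zeta> \<xi> where z: "S = {\<zeta>, \<xi>}" "strict_prefix \<zeta> \<xi>"
        proof -
          obtain \<zeta> \<xi> where "S = {\<zeta>, \<xi>}" "\<zeta> \<noteq> \<xi>"
            using S by (auto simp: card_2_iff)
          then show thesis
            using S that[of \<zeta> \<xi>] that[of \<xi> \<zeta>]
            by (auto simp: chain_def comparable_def strict_prefix_def insert_commute)
        qed
        \<comment> \<open>The diagonal grid: the same pair of nodes in every copy. A common solution
          for the two instances of \<psi> would realize all nodes of this grid.\<close>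
        let ?s = "\<lambda>\<eta>. (H \<eta> \<zeta>, H \<eta> \<xi>)"
        have "grid n A H ?s"
          using S z by (auto simp: grid_def)
        then have "\<not> C (doubled ?s A)"
          by (rule H(2))
        then show "\<not> (\<exists>b\<in>tuples M xs. \<forall>\<eta>\<in>S. realizes M \<psi> xs' ys' b (a' \<eta>))"
          unfolding C_def doubled_def z(1) using R' by fastforce
      qed
    qed
    then have "formula_has_k_ATP M \<psi> xs' ys' 2"
      using compactness_k_ATP[OF M \<psi>(1)] by simp
    then show ?thesis
      using \<psi>(1) by (auto simp: has_k_ATP_def)
  qed
qed

theorem lemma3p20:
  fixes L :: "('f, 'r) lang"
    and T :: "('f, 'r) fm set"
    and M :: "('f, 'r, 'm) struct"
    and \<kappa> :: "'k rel"
  assumes "complete_theory L T"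
    and "monster_model \<kappa> L T M"
  shows "(\<exists>k\<ge>2. has_k_ATP L M k) \<longleftrightarrow> has_ATP L M"
proof
  assume "\<exists>k\<ge>2. has_k_ATP L M k"
  then obtain k where k: "2 \<le> k" "has_k_ATP L M k"
    by blast
  then show "has_ATP L M"
  \<comment> \<open>The induction starts at \<open>2\<close>, which is ATP itself; each step yields
    the next lower case or ATP directly.\<close>
  proof (induction k rule: dec_induct)
    case (step k)
    then show ?case
      using k_ATP_step[OF assms(2)] by blast
  qed
qed auto

end
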